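(* Let $r\ge 1$, let $\mu\in\mathbb{C}$ with $\Re\mu>0$, let $h:\Delta\to\mathbb{C}$ be a $\mu$-spirallike function, and let $H:\mathbb{B}\to\mathbb{C}\times Y$ be defined by $$H(x,y):=\left(h(x),\,h'(x)^{\frac1r}y\right).$$ Suppose that $B\in L(Y)$ generates a semigroup of strict contractions. Then for each point $(z_0,w_0)\in H(\mathbb{B})$ and for all $t>0$, $$\left(e^{-\mu t}z_0+\gamma_t,\ e^{-\frac{\mu}{r}t}e^{-Bt}w_0\right)\in H(\mathbb{B})$$ whenever $\gamma_t\in\mathbb{C}$ satisfies $$|\gamma_t|<R_t=\frac{1-\|e^{-Bt}\|^r}{4}\,|h'(x_1)|(1-|x_1|^2),\qquad x_1=h^{-1}(e^{-\mu t}z_0).$$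
   Context: $\Delta=\{z\in\mathbb{C}:|z|<1\}$. $(Y,\|\cdot\|_Y)$ is a complex Banach space, $L(Y)$ is the space of bounded linear operators on $Y$, and for $r\ge1$, $$\mathbb{B}:=\{(x,y)\in\mathbb{C}\times Y:\ |x|^2+\|y\|_Y^r<1\},$$ which is the open unit ball of $\mathbb{C}\times Y$ for the norm given by the Minkowski functional of $\mathbb{B}$. A univalent (holomorphic, injective) function $h:\Delta\to\mathbb{C}$ is $\mu$-spirallike ($\Re\mu>0$) if $e^{-\mu t}h(\Delta)\subseteq h(\Delta)$ for all $t\ge0$ (no normalization is assumed; $0$ may lie in $h(\Delta)$ or on its boundary). The power $h'(x)^{1/r}$ denotes a fixed holomorphic branch on $\Delta$ (it exists since $h'$ has no zeros in $\Delta$). "$B$ generates a semigroup of strict contractions" means that $\|e^{-Bt}\|<1$ for all $t>0$, where $\|\cdot\|$ is the operator norm on $L(Y)$. *)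

theory Defs
  imports "HOL-Complex_Analysis.Complex_Analysis"
begin

text \<open>
  The libraries only know real Banach spaces. A complex Banach space is a real one whose
  scalar multiplication extends to the complex numbers, with the norm homogeneous over them.
\<close>

class complex_banach = banach +
  fixes scaleC :: "complex \<Rightarrow> 'a \<Rightarrow> 'a" (infixr "*\<^sub>C" 75)
  assumes scaleC_add_right: "a *\<^sub>C (x + y) = a *\<^sub>C x + a *\<^sub>C y"
    and scaleC_add_left: "(a + b) *\<^sub>C x = a *\<^sub>C x + b *\<^sub>C x"
    and scaleC_scaleC: "a *\<^sub>C b *\<^sub>C x = (a * b) *\<^sub>C x"
    and scaleC_of_real: "complex_of_real s *\<^sub>C x = s *\<^sub>R x"
    and norm_scaleC: "norm (a *\<^sub>C x) = cmod a * norm x"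

instantiation complex :: complex_banach
begin

definition scaleC_complex :: "complex \<Rightarrow> complex \<Rightarrow> complex"
  where "scaleC_complex a x = a * x"

instance
  by standard (simp_all add: scaleC_complex_def algebra_simps norm_mult scaleR_conv_of_real)

end

text \<open>
  \<open>L(Y)\<close> as a set of real bounded operators; the norm of \<^typ>\<open>'a \<Rightarrow>\<^sub>L 'a\<close> is the
  operator norm, which does not depend on the scalar field.
\<close>

definition bounded_clinear_ops :: "('a::complex_banach \<Rightarrow>\<^sub>L 'a) set"
  where "bounded_clinear_ops = {A. \<forall>c y. blinfun_apply A (c *\<^sub>C y) = c *\<^sub>C blinfun_apply A y}"

text \<open>
  The library's \<^const>\<open>exp\<close> needs a Banach algebra type, and bounded operators are no instance
  because the zero space is admitted. So the exponential series is written out, with convergence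
  in operator norm.
\<close>

definition blinfun_exp_term :: "('a::banach \<Rightarrow>\<^sub>L 'a) \<Rightarrow> nat \<Rightarrow> ('a \<Rightarrow>\<^sub>L 'a)"
  where "blinfun_exp_term A n = (1 / fact n) *\<^sub>R (((o\<^sub>L) A ^^ n) id_blinfun)"

definition blinfun_exp :: "('a::banach \<Rightarrow>\<^sub>L 'a) \<Rightarrow> ('a \<Rightarrow>\<^sub>L 'a)"
  where "blinfun_exp A = (\<Sum>n. blinfun_exp_term A n)"

lemma norm_blinfun_funpow_le:
  fixes A :: "'a::banach \<Rightarrow>\<^sub>L 'a"
  shows "norm (((o\<^sub>L) A ^^ n) id_blinfun) \<le> norm A ^ n"
proof (induction n)
  case 0
  show ?case by (simp add: norm_blinfun_id_le)
next
  case (Suc n)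
  have "norm (((o\<^sub>L) A ^^ Suc n) id_blinfun) \<le> norm A * norm (((o\<^sub>L) A ^^ n) id_blinfun)"
    by (simp add: norm_blinfun_compose)
  also have "\<dots> \<le> norm A * norm A ^ n"
    using Suc.IH by (intro mult_left_mono) auto
  finally show ?case by simp
qed

lemma summable_blinfun_exp_term: "summable (blinfun_exp_term A)"
proof (rule summable_comparison_test)
  show "\<exists>N. \<forall>n\<ge>N. norm (blinfun_exp_term A n) \<le> inverse (fact n) * norm A ^ n"
    by (auto simp: blinfun_exp_term_def divide_inverse intro!: mult_left_mono norm_blinfun_funpow_le)
  show "summable (\<lambda>n. inverse (fact n) * norm A ^ n)"
    by (rule summable_exp)
qed

lemma blinfun_exp_sums: "blinfun_exp_term A sums blinfun_exp A"
  unfolding blinfun_exp_def by (rule summable_sums[OF summable_blinfun_exp_term])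

definition generates_strict_contractions :: "('a::banach \<Rightarrow>\<^sub>L 'a) \<Rightarrow> bool"
  where "generates_strict_contractions B \<longleftrightarrow> (\<forall>t>0. norm (blinfun_exp (- (t *\<^sub>R B))) < 1)"

definition spirallike :: "complex \<Rightarrow> (complex \<Rightarrow> complex) \<Rightarrow> bool"
  where "spirallike \<mu> h \<longleftrightarrow>
    Re \<mu> > 0 \<and> h holomorphic_on ball 0 1 \<and> inj_on h (ball 0 1) \<and>
    (\<forall>t\<ge>0. (\<lambda>z. exp (- \<mu> * of_real t) * z) ` h ` ball 0 1 \<subseteq> h ` ball 0 1)"

text \<open>
  \<open>p\<close> is a holomorphic branch of \<open>f\<^sup>a\<close> on \<open>S\<close>, i.e. \<open>p = exp (a log f)\<close> for some holomorphic
  branch of \<open>log f\<close>.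
\<close>

definition power_branch_on :: "complex set \<Rightarrow> (complex \<Rightarrow> complex) \<Rightarrow> real \<Rightarrow> (complex \<Rightarrow> complex) \<Rightarrow> bool"
  where "power_branch_on S f a p \<longleftrightarrow>
    (\<exists>l. l holomorphic_on S \<and> (\<forall>x\<in>S. exp (l x) = f x \<and> p x = exp (of_real a * l x)))"

definition egg_ball :: "real \<Rightarrow> (complex \<times> 'a::complex_banach) set"
  where "egg_ball r = {(x, y). (cmod x)\<^sup>2 + norm y powr r < 1}"

text \<open>\<open>p\<close> plays the role of the chosen branch of \<open>h'\<^bsup>1/r\<^esup>\<close>.\<close>

definition extension_map ::
    "(complex \<Rightarrow> complex) \<Rightarrow> (complex \<Rightarrow> complex) \<Rightarrow> complex \<times> 'a \<Rightarrow> complex \<times> 'a::complex_banach"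
  where "extension_map h p = (\<lambda>(x, y). (h x, p x *\<^sub>C y))"

end

theory Submission
  imports Defs
begin

unbundle no fps_syntax

text \<open>
  Write \<open>z\<^sub>0 = h x\<^sub>0\<close>, \<open>w\<^sub>0 = p x\<^sub>0 y\<^sub>0\<close>, and let \<open>R x = |h'(x)| (1 - |x|\<^sup>2)\<close> be the conformal radius
  of \<open>h(\<Delta>)\<close> at \<open>h x\<close>. The Schwarz--Pick lemma for \<open>h\<^sup>-\<^sup>1 (e\<^sup>-\<^sup>\<mu>\<^sup>t h)\<close> gives
  \<open>|e\<^sup>-\<^sup>\<mu>\<^sup>t| R x\<^sub>0 \<le> R x\<^sub>1\<close>. By Koebe's quarter theorem the perturbed point \<open>h x\<^sub>1 + \<gamma>\<close> is some \<open>h x\<^sub>2\<close>,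
  and since the conformal radius is Lipschitz with constant \<open>4\<close>,
  \<open>R x\<^sub>2 \<ge> R x\<^sub>1 - 4 |\<gamma>| > \<parallel>e\<^sup>-\<^sup>B\<^sup>t\<parallel>\<^sup>r R x\<^sub>1\<close>. Together these bound the fibre coordinate over \<open>x\<^sub>2\<close>.

  The quarter theorem is derived from an area estimate in logarithmic coordinates. Composing with
  slit maps turns it into the lower growth estimate, whose expansion at the origin is
  \<open>|a\<^sub>2| \<le> 2\<close>; this integrates to the distortion theorem and the Lipschitz bound.
\<close>

subsection \<open>Areas of holomorphic images\<close>

text \<open>Images of holomorphic maps are measured as subsets of \<open>real^2\<close>, where the
  change of variables formula is expressed through the determinant of a matrix.\<close>

definition vec_of_complex :: "complex \<Rightarrow> real^2"
  where "vec_of_complex z = vector [Re z, Im z]"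

definition complex_of_vec :: "real^2 \<Rightarrow> complex"
  where "complex_of_vec v = Complex (v $ 1) (v $ 2)"

lemma vec_of_complex_inverse [simp]: "complex_of_vec (vec_of_complex z) = z"
  by (simp add: vec_of_complex_def complex_of_vec_def)

lemma complex_of_vec_inverse [simp]: "vec_of_complex (complex_of_vec v) = v"
  by (simp add: vec_of_complex_def complex_of_vec_def vec_eq_iff forall_2)

lemma bounded_linear_vec_of_complex: "bounded_linear vec_of_complex"
proof (rule linear_conv_bounded_linear[THEN iffD1], rule linearI)
qed (auto simp: vec_of_complex_def vec_eq_iff forall_2)

lemma bounded_linear_complex_of_vec: "bounded_linear complex_of_vec"
proof (rule linear_conv_bounded_linear[THEN iffD1], rule linearI)
qed (auto simp: complex_of_vec_def complex_eq_iff)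

lemma image_eqI_right_inverse:
  assumes "\<And>z. f z \<in> B \<longleftrightarrow> z \<in> A" "\<And>x. f (g x) = x"
  shows "f ` A = B"
proof
  show "B \<subseteq> f ` A"
  proof
    fix x assume "x \<in> B"
    then have "g x \<in> A" using assms by metis
    then show "x \<in> f ` A" using assms(2) by (metis imageI)
  qed
qed (use assms in auto)

lemma vec_of_complex_cbox: "vec_of_complex ` cbox u v = cbox (vec_of_complex u) (vec_of_complex v)"
proof -
  have "vec_of_complex z \<in> cbox (vec_of_complex u) (vec_of_complex v) \<longleftrightarrow> z \<in> cbox u v" for z
    by (auto simp: vec_of_complex_def mem_box_cart forall_2 in_cbox_complex_iff)
  then show ?thesis
    by (rule image_eqI_right_inverse) (rule complex_of_vec_inverse)
qed

text \<open>The coordinate identification of \<open>real \<times> real\<close> with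
  \<open>real^2\<close> maps boxes to boxes and preserves their content, so Fubini's theorem for
  pairs carries over.\<close>

lemma integral_vec2_eq_iterated:
  fixes f :: "real^2 \<Rightarrow> real"
  assumes "continuous_on (cbox u v) f"
  shows "integral (cbox u v) f
    = integral {u$1..v$1} (\<lambda>x. integral {u$2..v$2} (\<lambda>y. f (vector [x, y])))"
proof -
  define g :: "real \<times> real \<Rightarrow> real^2" where "g = (\<lambda>(x, y). vector [x, y])"
  define k :: "real^2 \<Rightarrow> real \<times> real" where "k = (\<lambda>v. (v$1, v$2))"
  have hg: "k (g x) = x" for x by (simp add: g_def k_def split: prod.split)
  have gh: "g (k x) = x" for x by (simp add: g_def k_def vec_eq_iff forall_2)
  have blg: "bounded_linear g"
    by (rule linear_conv_bounded_linear[THEN iffD1], rule linearI)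
       (auto simp: g_def vec_eq_iff forall_2)
  have gbox: "g ` cbox (p, q) (p', q') = cbox (g (p, q)) (g (p', q'))" for p q p' q'
  proof -
    have "g z \<in> cbox (g (p, q)) (g (p', q')) \<longleftrightarrow> z \<in> cbox (p, q) (p', q')" for z
      by (cases z) (simp add: g_def mem_box_cart forall_2 cbox_Pair_eq)
    then show ?thesis
      by (rule image_eqI_right_inverse) (rule gh)
  qed
  have kbox: "k ` cbox w w' = cbox (k w) (k w')" for w w'
  proof -
    have "k z \<in> cbox (k w) (k w') \<longleftrightarrow> z \<in> cbox w w'" for z
      by (auto simp: k_def mem_box_cart forall_2 cbox_Pair_eq)
    then show ?thesis
      by (rule image_eqI_right_inverse) (rule hg)
  qed
  \<comment> \<open>The scaling factor of the change of variables is \<open>1\<close>. Empty boxes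
    are treated apart because the product formula for the content holds only for nonempty
    ones.\<close>
  have cont: "measure lborel (g ` cbox w z) = 1 * measure lborel (cbox w z)" for w z
  proof (cases w; cases z)
    fix p q p' q' assume wz: "w = (p, q)" "z = (p', q')"
    show ?thesis
    proof (cases "p \<le> p' \<and> q \<le> q'")
      case True
      then have "cbox (g (p, q)) (g (p', q')) \<noteq> {}"
        unfolding gbox[symmetric] by (simp add: cbox_Pair_eq)
      then show ?thesis
        using True unfolding wz gbox content_cbox_cart[OF \<open>cbox (g (p, q)) (g (p', q')) \<noteq> {}\<close>]
        by (simp add: content_Pair g_def UNIV_2 content_real)
    next
      case False
      then have "cbox (p, q) (p', q') = {}" by (auto simp: cbox_Pair_eq)
      then show ?thesis by (simp add: wz)
    qed
  qed
  have "((\<lambda>x. f (g x)) has_integral (1 / 1) *\<^sub>R integral (cbox u v) f) (k ` cbox u v)"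
  proof (rule has_integral_twiddle[OF _ hg gh _ _ _ cont])
    show "continuous (at x) g" for x
      using blg by (simp add: linear_continuous_at)
    show "\<exists>w z. g ` cbox a b = cbox w z" for a b
      by (cases a; cases b) (auto simp: gbox)
    show "\<exists>w z. k ` cbox a b = cbox w z" for a b
      using kbox by blast
    show "(f has_integral integral (cbox u v) f) (cbox u v)"
      using assms integrable_continuous integrable_integral by blast
  qed auto
  then have "integral (cbox u v) f = integral (cbox (u$1, u$2) (v$1, v$2)) (\<lambda>x. f (g x))"
    unfolding kbox by (simp add: k_def integral_unique)
  also have "\<dots> = integral (cbox (u$1) (v$1)) (\<lambda>x. integral (cbox (u$2) (v$2)) (\<lambda>y. f (g (x, y))))"
  proof (rule integral_prod_continuous)
    have "g ` cbox (u$1, u$2) (v$1, v$2) = cbox u v"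
      using gh[of u] gh[of v] by (simp add: gbox k_def)
    then show "continuous_on (cbox (u$1, u$2) (v$1, v$2)) (\<lambda>x. f (g x))"
      using continuous_on_compose[of _ g f] blg assms linear_continuous_on[OF blg] by (simp add: o_def)
  qed
  finally show ?thesis by (simp add: g_def)
qed

text \<open>The real Jacobian of a holomorphic map is \<open>|L'|^2\<close>. By injectivity no part
  of the image is counted twice, so its area is the integral of the Jacobian.\<close>

lemma measure_holomorphic_image_cbox:
  assumes holL: "L holomorphic_on S" and "open S" and inj: "inj_on L S" and sub: "cbox u v \<subseteq> S"
  defines "A \<equiv> vec_of_complex ` L ` cbox u v"
  shows "A \<in> lmeasurable"
    and "measure lebesgue A = integral {Re u..Re v} (\<lambda>x. integral {Im u..Im v}
           (\<lambda>y. (cmod (deriv L (Complex x y)))\<^sup>2))"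
proof -
  define Q where "Q = cbox (vec_of_complex u) (vec_of_complex v)"
  define F where "F = vec_of_complex \<circ> L \<circ> complex_of_vec"
  define F' where "F' x = vec_of_complex \<circ> (*) (deriv L (complex_of_vec x)) \<circ> complex_of_vec" for x
  have inQ: "complex_of_vec x \<in> cbox u v" if "x \<in> Q" for x
    using that by (auto simp: Q_def vec_of_complex_cbox[symmetric])
  have A: "A = F ` Q"
    unfolding A_def F_def Q_def vec_of_complex_cbox[symmetric] by (auto simp: image_image)
  have der: "(F has_derivative F' x) (at x within Q)" if "x \<in> Q" for x
  proof -
    have "(L has_derivative (*) (deriv L (complex_of_vec x))) (at (complex_of_vec x))"
      using holomorphic_derivI[OF holL \<open>open S\<close> subsetD[OF sub inQ[OF that]]]
      by (simp add: has_field_derivative_def)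
    moreover have "(complex_of_vec has_derivative complex_of_vec) (at x within Q)"
      by (rule bounded_linear_imp_has_derivative[OF bounded_linear_complex_of_vec])
    ultimately have "(L \<circ> complex_of_vec has_derivative
        (*) (deriv L (complex_of_vec x)) \<circ> complex_of_vec) (at x within Q)"
      by (rule diff_chain_within[OF _ has_derivative_at_withinI, rotated])
    from diff_chain_within[OF this
        bounded_linear_imp_has_derivative[OF bounded_linear_vec_of_complex]]
    show ?thesis
      unfolding F_def F'_def o_assoc[symmetric] .
  qed
  have injF: "inj_on F Q"
  proof (rule inj_onI)
    fix x y assume "x \<in> Q" "y \<in> Q" "F x = F y"
    then have "L (complex_of_vec x) = L (complex_of_vec y)"
      by (metis F_def comp_apply vec_of_complex_inverse)
    then have "complex_of_vec x = complex_of_vec y"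
      using inj inQ sub \<open>x \<in> Q\<close> \<open>y \<in> Q\<close> by (meson inj_onD subsetD)
    then show "x = y" by (metis complex_of_vec_inverse)
  qed
  \<comment> \<open>Multiplication by \<open>a + i b\<close> has the real matrix with rows
    \<open>(a, -b)\<close> and \<open>(b, a)\<close>, whose determinant is
    \<open>a^2 + b^2\<close>.\<close>
  have det: "\<bar>det (matrix (F' x))\<bar> = (cmod (deriv L (complex_of_vec x)))\<^sup>2" for x
    by (simp add: det_2 matrix_def F'_def vec_of_complex_def complex_of_vec_def axis_def
        cmod_power2) (simp add: power2_eq_square)
  have contd: "continuous_on Q (\<lambda>x. (cmod (deriv L (complex_of_vec x)))\<^sup>2)"
  proof -
    have "continuous_on (cbox u v) (deriv L)"
      using holL \<open>open S\<close> sub holomorphic_deriv holomorphic_on_imp_continuous_on continuous_on_subset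
      by metis
    then have "continuous_on Q (deriv L \<circ> complex_of_vec)"
      using inQ by (intro continuous_on_compose linear_continuous_on[OF bounded_linear_complex_of_vec])
        (auto elim!: continuous_on_subset)
    then show ?thesis by (intro continuous_intros) (simp add: o_def)
  qed
  have Qm: "Q \<in> sets lebesgue" by (simp add: Q_def)
  have intg: "(\<lambda>x. \<bar>det (matrix (F' x))\<bar>) integrable_on Q"
    unfolding det using contd by (simp add: Q_def integrable_continuous)
  have hi: "A \<in> lmeasurable \<and> measure lebesgue A = integral Q (\<lambda>x. \<bar>det (matrix (F' x))\<bar>)"
    unfolding A using has_measure_differentiable_image[OF Qm der injF] intg
    by (simp add: has_integral_integrable_integral)
  show "A \<in> lmeasurable" using hi by simp
  have "measure lebesgue A = integral Q (\<lambda>x. (cmod (deriv L (complex_of_vec x)))\<^sup>2)"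
    using hi by (simp add: det)
  then show "measure lebesgue A = integral {Re u..Re v} (\<lambda>x. integral {Im u..Im v}
           (\<lambda>y. (cmod (deriv L (Complex x y)))\<^sup>2))"
    using integral_vec2_eq_iterated[OF contd[unfolded Q_def]]
    by (simp add: Q_def vec_of_complex_def complex_of_vec_def)
qed

text \<open>The lower bound comes from \<open>|q|\<^sup>2 \<ge> 2 Re q - 1\<close>, whose integral reduces to boundary terms.\<close>

lemma measure_near_identity_image_cbox:
  assumes holL: "L holomorphic_on S" and S: "open S" and inj: "inj_on L S"
    and sub: "cbox u v \<subseteq> S" and le: "Re u \<le> Re v" "Im u \<le> Im v"
    and near: "\<And>z. z \<in> cbox u v \<Longrightarrow> \<bar>Im (L z - z)\<bar> \<le> C"
  shows "(Re v - Re u) * (Im v - Im u - 4 * C) \<le> measure lebesgue (vec_of_complex ` L ` cbox u v)"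
proof -
  define q where "q x y = (cmod (deriv L (Complex x y)))\<^sup>2" for x y
  define R where "R = cbox (Re u, Im u) (Re v, Im v)"
  have contd: "continuous_on (cbox u v) (deriv L)"
    using holL S sub holomorphic_deriv holomorphic_on_imp_continuous_on continuous_on_subset
    by metis
  have contR: "continuous_on R (\<lambda>(x, y). q x y)"
  proof -
    have "continuous_on R (\<lambda>p. Complex (fst p) (snd p))"
      by (intro continuous_intros)
    then have "continuous_on R (deriv L \<circ> (\<lambda>p. Complex (fst p) (snd p)))"
      by (rule continuous_on_compose)
         (auto intro!: continuous_on_subset[OF contd] simp: R_def in_cbox_complex_iff cbox_Pair_eq)
    then have "continuous_on R (\<lambda>p. (cmod (deriv L (Complex (fst p) (snd p))))\<^sup>2)"
      by (intro continuous_intros) (simp add: o_def)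
    then show ?thesis by (simp add: q_def case_prod_beta)
  qed
  \<comment> \<open>On a vertical line \<open>Im L\<close> has derivative \<open>Re L'\<close>, so
    \<open>2 Re L' - 1\<close> integrates to twice the increment of \<open>Im L\<close> minus the
    height of the box. Each of the two endpoint values is off by at most \<open>C\<close>, and
    doubling gives the loss \<open>4 * C\<close>.\<close>
  have inner: "Im v - Im u - 4 * C \<le> integral {Im u..Im v} (q x)" if x: "x \<in> {Re u..Re v}" for x
  proof -
    have mem: "Complex x y \<in> cbox u v" if "y \<in> {Im u..Im v}" for y
      using x that by (simp add: in_cbox_complex_iff)
    have "((\<lambda>y. Im (L (Complex x y))) has_real_derivative Re (deriv L (Complex x y)))
        (at y within {Im u..Im v})" if y: "y \<in> {Im u..Im v}" for y
    proof -
      have 1: "(L has_field_derivative deriv L (Complex x y)) (at (Complex x y))"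
        using holomorphic_derivI[OF holL S] sub mem[OF y] by blast
      have "((\<lambda>y. Complex x y) has_vector_derivative \<i>) (at y within {Im u..Im v})"
        unfolding Complex_eq by (auto intro!: derivative_eq_intros simp: has_vector_derivative_of_real)
      from field_vector_diff_chain_within[OF this has_field_derivative_at_within[OF 1]]
      have "(L \<circ> Complex x has_vector_derivative \<i> * deriv L (Complex x y)) (at y within {Im u..Im v})" .
      then have "((\<lambda>y. Im ((L \<circ> Complex x) y)) has_vector_derivative Im (\<i> * deriv L (Complex x y)))
           (at y within {Im u..Im v})"
        by (rule bounded_linear.has_vector_derivative[OF bounded_linear_Im])
      then show ?thesis by (simp add: has_real_derivative_iff_has_vector_derivative)
    qed
    then have "((\<lambda>y. Re (deriv L (Complex x y))) has_integral
        Im (L (Complex x (Im v))) - Im (L (Complex x (Im u)))) {Im u..Im v}"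
      using le(2) by (intro fundamental_theorem_of_calculus)
        (auto simp: has_real_derivative_iff_has_vector_derivative)
    then have "((\<lambda>y. 2 * Re (deriv L (Complex x y)) - 1) has_integral
        2 * (Im (L (Complex x (Im v))) - Im (L (Complex x (Im u)))) - (Im v - Im u)) {Im u..Im v}"
      using le(2) has_integral_const_real[of "1::real" "Im u" "Im v"]
      by (intro has_integral_diff has_integral_mult_right) auto
    moreover have "continuous_on {Im u..Im v} (q x)"
    proof -
      have "continuous_on {Im u..Im v} ((\<lambda>(x, y). q x y) \<circ> Pair x)"
        by (intro continuous_on_compose continuous_intros continuous_on_subset[OF contR])
           (use x in \<open>auto simp: R_def cbox_Pair_eq\<close>)
      then show ?thesis by (simp add: o_def)
    qed
    then have "(q x has_integral integral {Im u..Im v} (q x)) {Im u..Im v}"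
      using integrable_continuous_real integrable_integral by blast
    ultimately have "2 * (Im (L (Complex x (Im v))) - Im (L (Complex x (Im u)))) - (Im v - Im u)
        \<le> integral {Im u..Im v} (q x)"
    proof (rule has_integral_le)
      fix y
      have "0 \<le> (Re (deriv L (Complex x y)) - 1)\<^sup>2 + (Im (deriv L (Complex x y)))\<^sup>2"
        by simp
      then show "2 * Re (deriv L (Complex x y)) - 1 \<le> q x y"
        unfolding q_def cmod_power2 by (simp add: power2_eq_square algebra_simps)
    qed
    moreover have "\<bar>Im (L (Complex x (Im v))) - Im v\<bar> \<le> C" "\<bar>Im (L (Complex x (Im u))) - Im u\<bar> \<le> C"
      using near[OF mem[of "Im v"]] near[OF mem[of "Im u"]] le(2) by auto
    ultimately show ?thesis
      unfolding abs_le_iff right_diff_distrib by linarith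
  qed
  have "(Re v - Re u) * (Im v - Im u - 4 * C) = integral {Re u..Re v} (\<lambda>x. Im v - Im u - 4 * C)"
    using le by simp
  also have "\<dots> \<le> integral {Re u..Re v} (\<lambda>x. integral {Im u..Im v} (q x))"
  proof (rule integral_le)
    show "(\<lambda>x. integral {Im u..Im v} (q x)) integrable_on {Re u..Re v}"
      using integral_integrable_2dim[of "Re u" "Im u" "Re v" "Im v" "\<lambda>(x, y). q x y"] contR
      by (simp add: R_def)
  qed (use inner in auto)
  also have "\<dots> = measure lebesgue (vec_of_complex ` L ` cbox u v)"
    using measure_holomorphic_image_cbox(2)[OF holL S inj sub] by (simp add: q_def[abs_def])
  finally show ?thesis .
qed

lemma measure_vec_of_complex_cbox:
  assumes "Re u \<le> Re v" "Im u \<le> Im v"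
  shows "measure lebesgue (vec_of_complex ` cbox u v) = (Re v - Re u) * (Im v - Im u)"
proof -
  have "cbox (vec_of_complex u) (vec_of_complex v) \<noteq> {}"
    unfolding vec_of_complex_cbox[symmetric] using assms by (auto simp: in_cbox_complex_iff)
  from content_cbox_cart[OF this] show ?thesis
    unfolding vec_of_complex_cbox by (simp add: vec_of_complex_def UNIV_2)
qed

text \<open>Compare the areas of \<open>L\<close> and \<open>- L\<close> on the box \<open>{a..b} \<times> {-T..T}\<close> with that of
  \<open>{-X..X} \<times> {-T-C..T+C}\<close>, and let \<open>T\<close> tend to infinity.\<close>

lemma nonoverlapping_strip_bound:
  assumes holL: "L holomorphic_on S" and S: "open S" and inj: "inj_on L S"
    and sub: "{z. a \<le> Re z \<and> Re z \<le> b} \<subseteq> S" and ab: "a \<le> b"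
    and near: "\<And>z. a \<le> Re z \<Longrightarrow> Re z \<le> b \<Longrightarrow> cmod (L z - z) \<le> C"
    and bound: "\<And>z. a \<le> Re z \<Longrightarrow> Re z \<le> b \<Longrightarrow> \<bar>Re (L z)\<bar> \<le> X"
    and disj: "\<And>z w. z \<in> S \<Longrightarrow> w \<in> S \<Longrightarrow> L z \<noteq> - L w"
  shows "b - a \<le> X"
proof (rule ccontr)
  assume "\<not> b - a \<le> X"
  then have gap: "0 < (b - a) - X" by simp
  have C: "0 \<le> C"
    by (rule order_trans[OF norm_ge_zero near[of "of_real a"]]) (use ab in auto)
  have X: "0 \<le> X" using bound[of "of_real a"] ab by auto
  have ineq: "(b - a) * (T - 2 * C) \<le> X * (T + C)" if T: "T \<ge> 0" for T
  proof -
    define u v where "u = Complex a (-T)" and "v = Complex b T"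
    define P where "P = Complex (-X) (-T - C)"
    define A where "A = vec_of_complex ` L ` cbox u v"
    define A' where "A' = vec_of_complex ` (\<lambda>z. - L z) ` cbox u v"
    have uv: "Re u \<le> Re v" "Im u \<le> Im v" using ab T by (auto simp: u_def v_def)
    have box: "a \<le> Re z" "Re z \<le> b" "-T \<le> Im z" "Im z \<le> T" if "z \<in> cbox u v" for z
      using that by (auto simp: in_cbox_complex_iff u_def v_def)
    have boxS: "cbox u v \<subseteq> S" using sub box by blast
    have hol': "(\<lambda>z. - L z) holomorphic_on S" by (intro holomorphic_intros holL)
    have inj': "inj_on (\<lambda>z. - L z) S" using inj by (auto simp: inj_on_def)
    have nearIm: "\<bar>Im (L z - z)\<bar> \<le> C" if "z \<in> cbox u v" for z
      using near[of z] box[OF that] abs_Im_le_cmod[of "L z - z"] by linarith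
    have A: "A \<in> lmeasurable" "A' \<in> lmeasurable"
      using measure_holomorphic_image_cbox(1)[OF holL S inj boxS]
        measure_holomorphic_image_cbox(1)[OF hol' S inj' boxS] by (simp_all add: A_def A'_def)
    have lower: "(b - a) * (2 * T - 4 * C) \<le> measure lebesgue A"
      using measure_near_identity_image_cbox[OF holL S inj boxS uv nearIm]
      by (simp add: A_def u_def v_def)
    have "cmod (deriv (\<lambda>z. - L z) z) = cmod (deriv L z)" if "z \<in> cbox u v" for z
      using holomorphic_on_imp_differentiable_at[OF holL S] boxS that by (subst deriv_minus) auto
    then have eq: "measure lebesgue A' = measure lebesgue A"
      unfolding A_def A'_def measure_holomorphic_image_cbox(2)[OF holL S inj boxS]
        measure_holomorphic_image_cbox(2)[OF hol' S inj' boxS]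
      by (intro integral_cong) (simp add: in_cbox_complex_iff)
    have disjA: "A \<inter> A' = {}"
    proof -
      have "L z \<noteq> - L w" if "z \<in> cbox u v" "w \<in> cbox u v" for z w
        using disj boxS that by blast
      then show ?thesis
        by (auto simp: A_def A'_def dest!: arg_cong[of _ _ complex_of_vec])
    qed
    have inP: "L z \<in> cbox P (- P)" "- L z \<in> cbox P (- P)" if "z \<in> cbox u v" for z
      using bound[of z] box[OF that] nearIm[OF that] by (auto simp: in_cbox_complex_iff P_def)
    have "2 * measure lebesgue A = measure lebesgue (A \<union> A')"
      using measure_Un3[OF A] disjA eq by simp
    also have "\<dots> \<le> measure lebesgue (vec_of_complex ` cbox P (- P))"
    proof (rule measure_mono_fmeasurable)
      show "A \<union> A' \<subseteq> vec_of_complex ` cbox P (- P)"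
        unfolding A_def A'_def image_image using inP by blast
      show "A \<union> A' \<in> sets lebesgue"
        using A by blast
      show "vec_of_complex ` cbox P (- P) \<in> lmeasurable"
        by (simp add: vec_of_complex_cbox)
    qed
    also have "\<dots> = (2 * X) * (2 * T + 2 * C)"
      using X T C by (simp add: measure_vec_of_complex_cbox P_def)
    finally show ?thesis using lower by (simp add: algebra_simps)
  qed
  \<comment> \<open>This height makes \<open>((b - a) - X) * T\<close> exceed
    \<open>X * C + 2 * (b - a) * C\<close> by exactly \<open>1\<close>, whereas \<open>ineq\<close>
    allows no excess.\<close>
  define T where "T = (X * C + 2 * (b - a) * C + 1) / ((b - a) - X)"
  have T0: "T \<ge> 0" unfolding T_def using gap X C ab by (intro divide_nonneg_pos add_nonneg_nonneg mult_nonneg_nonneg) auto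
  have "((b - a) - X) * T = X * C + 2 * (b - a) * C + 1"
    unfolding T_def using gap by simp
  with ineq[OF T0] show False by (simp add: algebra_simps)
qed

subsection \<open>The quarter theorem and the growth estimate\<close>

text \<open>This is the Bieberbach--Eilenberg inequality. Writing \<open>f z = z exp (k z)\<close>, in logarithmic
  coordinates \<open>f\<close> becomes \<open>L z = z + k (exp z)\<close>, and the images of \<open>L\<close> and \<open>- L\<close> are disjoint.\<close>

lemma disjoint_reciprocal_deriv_le_1:
  assumes hol: "f holomorphic_on ball 0 1" and inj: "inj_on f (ball 0 1)" and f0: "f 0 = 0"
    and disj: "\<And>z w. z \<in> ball 0 1 \<Longrightarrow> w \<in> ball 0 1 \<Longrightarrow> f z * f w \<noteq> 1"
  shows "cmod (deriv f 0) \<le> 1"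
proof (rule ccontr)
  define m where "m = cmod (deriv f 0)"
  assume "\<not> cmod (deriv f 0) \<le> 1"
  then have m: "m > 1" by (simp add: m_def)
  obtain h where holh: "h holomorphic_on ball 0 1" and fh: "\<And>z. norm z < 1 \<Longrightarrow> f z = z * h z"
      and h0: "deriv f 0 = h 0"
    using Schwarz3[OF hol f0] by blast
  have "h z \<noteq> 0" if z: "z \<in> ball 0 1" for z
  proof (cases "z = 0")
    case True
    then show ?thesis using holomorphic_injective_imp_regular[OF hol open_ball inj, of 0] h0 by simp
  next
    case False
    then have "f z \<noteq> f 0" using inj z by (auto simp: inj_on_def)
    then show ?thesis using fh[of z] z f0 by auto
  qed
  \<comment> \<open>The quotient \<open>h\<close> of \<open>f\<close> by the identity has no zeros:
    \<open>h 0\<close> is the derivative of an injective map, and elsewhere injectivity forbids a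
    second zero of \<open>f\<close>. On the disc it therefore has a logarithm.\<close>
  then obtain k where holk: "k holomorphic_on ball 0 1" and hk: "\<And>z. z \<in> ball 0 1 \<Longrightarrow> h z = exp (k z)"
    using contractible_imp_holomorphic_log[OF holh] convex_imp_contractible[OF convex_ball] by metis
  define S where "S = {z::complex. Re z < 0}"
  define L where "L z = z + k (exp z)" for z
  have inball: "exp z \<in> ball 0 1" if "z \<in> S" for z
    using that by (simp add: S_def norm_exp_eq_Re)
  have expL: "exp (L z) = f (exp z)" if "z \<in> S" for z
    using fh[of "exp z"] hk[of "exp z"] inball[OF that] by (simp add: L_def exp_add)
  have S: "open S" unfolding S_def by (rule open_halfspace_Re_lt)
  have holL: "L holomorphic_on S"
  proof -
    have "(k \<circ> exp) holomorphic_on S"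
      by (rule holomorphic_on_compose[OF holomorphic_on_exp holomorphic_on_subset[OF holk]])
         (use inball in auto)
    then show ?thesis unfolding L_def o_def by (intro holomorphic_intros)
  qed
  have injL: "inj_on L S"
  proof (rule inj_onI)
    fix z w assume zw: "z \<in> S" "w \<in> S" "L z = L w"
    then have "f (exp z) = f (exp w)" using expL by metis
    then have "exp z = exp w" using inj inball zw by (meson inj_onD)
    \<comment> \<open>Equal exponentials alone determine a point only modulo the period; but now the
      terms \<open>k (exp z)\<close> and \<open>k (exp w)\<close> agree and cancel.\<close>
    then show "z = w" using zw(3) by (simp add: L_def)
  qed
  have disjL: "L z \<noteq> - L w" if "z \<in> S" "w \<in> S" for z w
  proof
    assume "L z = - L w"
    then have "exp (L z) * exp (L w) = 1" by (simp add: exp_minus)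
    then show False using expL disj inball that by metis
  qed
  obtain g where holg: "g holomorphic_on f ` ball 0 1"
      and dg: "\<And>z. z \<in> ball 0 1 \<Longrightarrow> deriv f z * deriv g (f z) = 1"
      and gf: "\<And>z. z \<in> ball 0 1 \<Longrightarrow> g (f z) = z"
    using holomorphic_has_inverse[OF hol open_ball inj] by blast
  have openf: "open (f ` ball 0 1)" by (rule open_mapping_thm3[OF hol open_ball inj])
  have in0: "0 \<in> f ` ball 0 1" using f0 by (metis centre_in_ball image_eqI zero_less_one)
  have g0: "g 0 = 0" using gf[of 0] f0 by simp
  have dg0: "cmod (deriv g 0) = 1 / m"
    using arg_cong[OF dg[of 0], of cmod] f0 m
    by (subst nonzero_eq_divide_eq) (auto simp: m_def norm_mult mult.commute)
  \<comment> \<open>The inverse \<open>g\<close> has derivative of modulus \<open>1 / m < 1\<close>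
    at the origin. Any \<open>q\<close> strictly between \<open>1 / m\<close> and \<open>1\<close>
    satisfies \<open>|g v| \<le> q |v|\<close> near \<open>0\<close>; the midpoint is taken.\<close>
  define q where "q = (1 + 1 / m) / 2"
  have q: "0 < q" "q < 1" "1 / m < q" using m by (auto simp: q_def field_simps)
  have "((\<lambda>v. (g v - g 0) / (v - 0)) \<longlongrightarrow> deriv g 0) (at 0)"
    using holomorphic_derivI[OF holg openf in0] by (simp add: has_field_derivative_iff)
  then have "((\<lambda>v. cmod (g v / v)) \<longlongrightarrow> 1 / m) (at 0)"
    using tendsto_norm g0 dg0 by fastforce
  then have "eventually (\<lambda>v. cmod (g v / v) < q) (at 0)"
    using q(3) order_tendstoD(2) by blast
  then obtain e1 where e1: "e1 > 0" "\<And>v. v \<noteq> 0 \<Longrightarrow> dist v 0 < e1 \<Longrightarrow> cmod (g v / v) < q"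
    unfolding eventually_at by blast
  obtain e2 where e2: "e2 > 0" "ball 0 e2 \<subseteq> f ` ball 0 1"
    using openf in0 open_contains_ball by blast
  define d where "d = min (min e1 e2) 1 / 2"
  have d: "0 < d" "d < e1" "d < e2" "d < 1" using e1 e2 by (auto simp: d_def)
  have gq: "cmod (g v) \<le> q * cmod v" if "cmod v < d" for v
  proof (cases "v = 0")
    case False
    then have "cmod (g v / v) < q" using e1(2)[of v] that d by auto
    then show ?thesis using False by (simp add: norm_divide field_simps)
  qed (simp add: g0)
  \<comment> \<open>The strip is too long for its image: \<open>b - a\<close> is
    \<open>- ln d - ln q / 2\<close>, which exceeds \<open>- ln d\<close>. The left edge is placed
    so that \<open>|exp z| \<ge> q * d\<close> forces \<open>|f (exp z)| \<ge> d\<close>, and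
    \<open>b < 0\<close> keeps \<open>exp z\<close> in a compact disc on which \<open>k\<close> is
    bounded.\<close>
  define b where "b = ln q / 2"
  define a where "a = ln (q * d)"
  have a: "a = ln q + ln d" using q d by (simp add: a_def ln_mult)
  have lnq: "ln q < 0" and lnd: "ln d < 0" using q d by simp_all
  have ab: "a \<le> b" "b < 0" using lnq lnd by (simp_all add: a b_def)
  have "bounded (k ` cball 0 (exp b))"
  proof -
    have b1: "exp b < 1" using ab by simp
    have "cball 0 (exp b) \<subseteq> (ball 0 1 :: complex set)"
      by (rule cball_subset_ball_iff[THEN iffD2]) (use b1 in simp)
    then have "continuous_on (cball 0 (exp b)) k"
      by (intro holomorphic_on_imp_continuous_on holomorphic_on_subset[OF holk])
    then show ?thesis
      using compact_continuous_image compact_cball compact_imp_bounded by blast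
  qed
  then obtain C where C: "\<And>z. z \<in> cball 0 (exp b) \<Longrightarrow> cmod (k z) \<le> C"
    unfolding bounded_iff by blast
  have "b - a \<le> - ln d"
  proof (rule nonoverlapping_strip_bound[OF holL S injL])
    show "{z. a \<le> Re z \<and> Re z \<le> b} \<subseteq> S" using ab by (auto simp: S_def)
    show "a \<le> b" by (rule ab)
    show "L z \<noteq> - L w" if "z \<in> S" "w \<in> S" for z w by (rule disjL[OF that])
    fix z assume z: "a \<le> Re z" "Re z \<le> b"
    then have zS: "z \<in> S" using ab by (simp add: S_def)
    show "cmod (L z - z) \<le> C"
      using C[of "exp z"] z by (simp add: L_def norm_exp_eq_Re)
    have "\<not> cmod (f (exp z)) < d"
    proof
      assume lt: "cmod (f (exp z)) < d"
      then have "cmod (exp z) < q * d"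
        using gq[OF lt] gf[OF inball[OF zS]] q(1) by (smt (verit) mult_strict_left_mono)
      then have "exp (Re z) < exp a" using q d by (simp add: norm_exp_eq_Re a_def)
      then show False using z by simp
    qed
    \<comment> \<open>A value of modulus above \<open>1 / d\<close> would have its reciprocal in
      \<open>ball 0 e2\<close>, hence again in the image of \<open>f\<close>, contrary to
      disjointness.\<close>
    moreover have "\<not> cmod (f (exp z)) > 1 / d"
    proof
      assume gt: "cmod (f (exp z)) > 1 / d"
      have nz: "f (exp z) \<noteq> 0" using gt d by auto
      have "cmod (1 / f (exp z)) < d" using gt d nz by (simp add: norm_divide field_simps)
      then have "1 / f (exp z) \<in> f ` ball 0 1" using d e2 by (auto simp: subset_iff)
      then obtain w where w: "w \<in> ball 0 1" "1 / f (exp z) = f w" by blast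
      then have "f (exp z) * f w = 1" using nz by (metis nonzero_mult_div_cancel_left times_divide_eq_right mult.right_neutral)
      then show False using disj[OF inball[OF zS] w(1)] by simp
    qed
    moreover have "exp (Re (L z)) = cmod (f (exp z))"
      using expL[OF zS] by (metis norm_exp_eq_Re)
    ultimately have "exp (ln d) \<le> exp (Re (L z))" "exp (Re (L z)) \<le> exp (ln (1 / d))"
      using d by auto
    then have "ln d \<le> Re (L z)" "Re (L z) \<le> ln (1 / d)"
      by (simp_all only: exp_le_cancel_iff)
    then show "\<bar>Re (L z)\<bar> \<le> - ln d" using d by (simp add: ln_div)
  qed
  then show False using lnq by (simp add: a b_def)
qed

lemma mobius_cayley_eq_iff:
  fixes u v :: complex
  assumes "u + 1 \<noteq> 0" "v + 1 \<noteq> 0"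
  shows "(u - 1) / (u + 1) = (v - 1) / (v + 1) \<longleftrightarrow> u = v"
  using assms by (auto simp: frac_eq_eq algebra_simps)

text \<open>Where the root equals \<open>1\<close>, taking the square root halves the derivative and
  the Cayley transform halves it again. This factor is the source of the constant \<open>4\<close>
  in the quarter theorem.\<close>

lemma deriv_cayley_sqrt:
  fixes u :: "complex \<Rightarrow> complex"
  assumes hol: "u holomorphic_on S" "open S" "x \<in> S" and sq: "\<And>z. z \<in> S \<Longrightarrow> (u z)\<^sup>2 = G z"
    and ux: "u x = 1" and dG: "(G has_field_derivative D) (at x)"
  shows "deriv (\<lambda>z. (u z - 1) / (u z + 1)) x = D / 4"
proof -
  have du: "(u has_field_derivative deriv u x) (at x)" by (rule holomorphic_derivI[OF hol])
  then have "((\<lambda>z. (u z)\<^sup>2) has_field_derivative 2 * deriv u x) (at x)"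
    by (auto intro!: derivative_eq_intros simp: ux)
  then have "(G has_field_derivative 2 * deriv u x) (at x)"
    by (rule has_field_derivative_transform_within_open[OF _ hol(2,3)]) (use sq in auto)
  then have D: "D = 2 * deriv u x" using dG DERIV_unique by blast
  have "((\<lambda>z. (u z - 1) / (u z + 1)) has_field_derivative deriv u x / 2) (at x)"
    using du by (auto intro!: derivative_eq_intros simp: ux)
  then show ?thesis by (simp add: D DERIV_imp_deriv)
qed

text \<open>The square root of \<open>1 - (f - f 0) / (c - f 0)\<close> maps into a domain disjoint from its negative;
  a Cayley transform turns this into a domain disjoint from its reciprocal.\<close>

lemma koebe_quarter:
  assumes hol: "f holomorphic_on ball 0 1" and inj: "inj_on f (ball 0 1)"
    and c: "c \<notin> f ` ball 0 1"
  shows "cmod (deriv f 0) \<le> 4 * cmod (c - f 0)"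
proof -
  define c' where "c' = c - f 0"
  have c': "c' \<noteq> 0" using c by (auto simp: c'_def)
  define G where "G z = 1 - (f z - f 0) / c'" for z
  have "G holomorphic_on ball 0 1" unfolding G_def by (intro holomorphic_intros hol c')
  moreover have Gnz: "G z \<noteq> 0" if "z \<in> ball 0 1" for z
    using c c' that by (auto simp: G_def c'_def field_simps)
  ultimately obtain g where holg: "g holomorphic_on ball 0 1" and g: "\<And>z. z \<in> ball 0 1 \<Longrightarrow> G z = g z ^ 2"
    using contractible_imp_holomorphic_sqrt[of G "ball 0 1"] convex_imp_contractible[OF convex_ball] by metis
  have g0: "(g 0)\<^sup>2 = 1" using g[of 0] by (simp add: G_def)
  then have g0nz: "g 0 \<noteq> 0" by auto
  \<comment> \<open>The root satisfies \<open>g 0 = 1\<close> or \<open>g 0 = -1\<close>; the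
    division selects the branch with value \<open>1\<close> at the origin.\<close>
  define u where "u z = g z / g 0" for z
  have holu: "u holomorphic_on ball 0 1" unfolding u_def by (intro holomorphic_intros holg g0nz)
  have u0: "u 0 = 1" using g0nz by (simp add: u_def)
  have u2: "(u z)\<^sup>2 = G z" if "z \<in> ball 0 1" for z
    using g[OF that] g0 by (simp add: u_def power_divide)
  have Ginj: "z = w" if "z \<in> ball 0 1" "w \<in> ball 0 1" "G z = G w" for z w
    using that inj c' by (auto simp: G_def inj_on_def)
  have usum: "u z + u w \<noteq> 0" if zw: "z \<in> ball 0 1" "w \<in> ball 0 1" for z w
  proof
    assume s: "u z + u w = 0"
    then have "u z = - u w" by (simp add: eq_neg_iff_add_eq_0)
    then have "G z = G w" using u2 zw by (metis power2_minus)
    then have "z = w" using Ginj zw by blast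
    then have "u z = 0" using s by simp
    then show False using Gnz[OF zw(1)] u2[OF zw(1)] by simp
  qed
  have u1: "u z + 1 \<noteq> 0" if "z \<in> ball 0 1" for z
    using usum[OF that, of 0] u0 by simp
  define v where "v z = (u z - 1) / (u z + 1)" for z
  have "cmod (deriv v 0) \<le> 1"
  proof (rule disjoint_reciprocal_deriv_le_1)
    show "v holomorphic_on ball 0 1" unfolding v_def by (intro holomorphic_intros holu u1)
    show "v 0 = 0" by (simp add: v_def u0)
    show "inj_on v (ball 0 1)"
      unfolding v_def inj_on_def using mobius_cayley_eq_iff u1 u2 Ginj by metis
    show "v z * v w \<noteq> 1" if zw: "z \<in> ball 0 1" "w \<in> ball 0 1" for z w
    proof
      assume "v z * v w = 1"
      then have "(u z - 1) * (u w - 1) = (u z + 1) * (u w + 1)"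
        using u1[OF zw(1)] u1[OF zw(2)] by (simp add: v_def field_simps)
      then have "2 * (u z + u w) = 0" by algebra
      then have "u z + u w = 0" by (simp del: distrib_left_numeral)
      then show False using usum[OF zw] by simp
    qed
  qed
  moreover have "deriv v 0 = (- deriv f 0 / c') / 4"
    unfolding v_def
  proof (rule deriv_cayley_sqrt[OF holu open_ball _ u2 u0])
    show "(G has_field_derivative - deriv f 0 / c') (at 0)"
      unfolding G_def using holomorphic_derivI[OF hol open_ball, of 0] c'
      by (auto intro!: derivative_eq_intros)
  qed auto
  ultimately show ?thesis using c' by (simp add: norm_divide divide_le_eq flip: c'_def)
qed

text \<open>The conjugate of \<open>z \<mapsto> t z\<close> by the Koebe function \<open>z / (1 - z)\<^sup>2\<close>, with \<open>t\<close> chosen so that the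
  tip of the slit is \<open>-\<rho>\<close>.\<close>

lemma radial_slit_map:
  assumes \<rho>: "0 < \<rho>" "\<rho> < 1"
  obtains \<kappa> :: "complex \<Rightarrow> complex" where "\<kappa> holomorphic_on ball 0 1" "inj_on \<kappa> (ball 0 1)"
    "\<kappa> ` ball 0 1 \<subseteq> ball 0 1" "\<kappa> 0 = 0" "deriv \<kappa> 0 = of_real (4 * \<rho> / (1 + \<rho>)\<^sup>2)" "- of_real \<rho> \<notin> \<kappa> ` ball 0 1"
proof -
  define t where "t = 4 * \<rho> / (1 + \<rho>)\<^sup>2"
  have t1: "1 - t = ((1 - \<rho>) / (1 + \<rho>))\<^sup>2"
    using \<rho> by (simp add: t_def power_divide field_simps) (simp add: power2_eq_square algebra_simps)
  have "0 < ((1 - \<rho>) / (1 + \<rho>))\<^sup>2"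
    using \<rho> by (intro zero_less_power divide_pos_pos) auto
  then have t: "0 < t" "t < 1"
    using t1 \<rho> by (simp add: t_def, linarith)
  \<comment> \<open>Since \<open>q^2 = 1 + 4 z / (1 - z)^2\<close>, the function \<open>W\<close> is
    \<open>1 + 4 t\<close> times the Koebe function. The map \<open>\<kappa>\<close> below satisfies
    \<open>q (\<kappa> z) = u z\<close>, so it is the conjugate of scaling by
    \<open>t\<close>.\<close>
  define q :: "complex \<Rightarrow> complex" where "q z = (1 + z) / (1 - z)" for z
  define W where "W z = 1 - of_real t + of_real t * (q z)\<^sup>2" for z
  define u where "u z = csqrt (W z)" for z
  have z1: "1 - z \<noteq> 0" if "z \<in> ball 0 1" for z :: complex using that by auto
  have Req: "Re (q z) > 0" if "z \<in> ball 0 1" for z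
  proof -
    have "Re (q z) = (1 - (cmod z)\<^sup>2) / (cmod (1 - z))\<^sup>2"
      unfolding q_def Re_divide cmod_power2 by (simp add: power2_eq_square algebra_simps)
    moreover have "(cmod z)\<^sup>2 < 1" using that by (simp add: power_less_one_iff abs_square_less_1)
    ultimately show ?thesis using z1[OF that] by simp
  qed
  \<comment> \<open>A real value of \<open>W\<close> forces \<open>q^2\<close> to be real; as
    \<open>q\<close> lies in the right half-plane, \<open>q\<close> is then real and
    \<open>W \<ge> 1 - t > 0\<close>. Hence the principal square root is holomorphic along
    \<open>W\<close>.\<close>
  have Wnp: "W z \<notin> \<real>\<^sub>\<le>\<^sub>0" if z: "z \<in> ball 0 1" for z
  proof
    assume W: "W z \<in> \<real>\<^sub>\<le>\<^sub>0"
    then have "Im (W z) = 0" "Re (W z) \<le> 0" by (auto simp: complex_nonpos_Reals_iff)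
    then have "Im (q z) = 0" using t Req[OF z] by (simp add: W_def power2_eq_square)
    then have "Re (W z) = 1 - t + t * (Re (q z))\<^sup>2" by (simp add: W_def power2_eq_square)
    then have "Re (W z) > 0" using t by (simp add: add_pos_nonneg)
    with \<open>Re (W z) \<le> 0\<close> show False by simp
  qed
  have u2: "(u z)\<^sup>2 = W z" for z by (simp add: u_def)
  have Reu: "Re (u z) > 0" if z: "z \<in> ball 0 1" for z
  proof -
    have "Re (u z) \<noteq> 0"
    proof
      assume 0: "Re (u z) = 0"
      then have "u z = \<i> * of_real (Im (u z))" by (simp add: complex_eq_iff)
      then have "W z = - of_real ((Im (u z))\<^sup>2)" 
        using u2[of z] by (metis power_mult_distrib power2_i mult_minus1 of_real_power)
      then show False using Wnp[OF z] by (auto simp: complex_nonpos_Reals_iff)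
    qed
    moreover have "Re (u z) \<ge> 0" unfolding u_def using csqrt_principal[of "W z"] by auto
    ultimately show ?thesis by simp
  qed
  have u1: "u z + 1 \<noteq> 0" if z: "z \<in> ball 0 1" for z
  proof
    assume "u z + 1 = 0"
    then have "Re (u z) + 1 = 0" by (metis plus_complex.sel(1) one_complex.sel(1) zero_complex.sel(1))
    then show False using Reu[OF z] by simp
  qed
  define \<kappa> where "\<kappa> z = (u z - 1) / (u z + 1)" for z
  have holq: "q holomorphic_on ball 0 1" unfolding q_def by (intro holomorphic_intros) (use z1 in auto)
  then have holW: "W holomorphic_on ball 0 1" unfolding W_def by (intro holomorphic_intros)
  have holu: "u holomorphic_on ball 0 1" unfolding u_def
    by (intro holomorphic_on_csqrt' holW Wnp)
  have u0: "u 0 = 1" by (simp add: u_def W_def q_def)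
  show thesis
  proof
    show "\<kappa> holomorphic_on ball 0 1" unfolding \<kappa>_def by (intro holomorphic_intros holu u1)
    show "\<kappa> 0 = 0" by (simp add: \<kappa>_def u0)
    show "inj_on \<kappa> (ball 0 1)"
    proof (rule inj_onI)
      fix z w assume zw: "z \<in> ball 0 1" "w \<in> ball 0 1" "\<kappa> z = \<kappa> w"
      then have "u z = u w" using mobius_cayley_eq_iff u1 by (simp add: \<kappa>_def)
      then have "W z = W w" using u2 by metis
      then have "(q z)\<^sup>2 = (q w)\<^sup>2" using t by (simp add: W_def)
      then have "q z = q w \<or> q z = - q w" by (simp add: power2_eq_iff)
      then have "q z = q w" using Req[OF zw(1)] Req[OF zw(2)] by auto
      then show "z = w" using z1[OF zw(1)] z1[OF zw(2)] by (simp add: q_def frac_eq_eq algebra_simps)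
    qed
    show "\<kappa> ` ball 0 1 \<subseteq> ball 0 1"
    proof clarify
      fix z :: complex assume z: "z \<in> ball 0 1"
      have "(cmod (u z - 1))\<^sup>2 < (cmod (u z + 1))\<^sup>2"
        using Reu[OF z] unfolding cmod_power2 by (simp add: power2_eq_square algebra_simps)
      then have "cmod (u z - 1) < cmod (u z + 1)" by (rule power2_less_imp_less) simp
      then show "\<kappa> z \<in> ball 0 1" using u1[OF z] by (simp add: \<kappa>_def norm_divide)
    qed
    show "- of_real \<rho> \<notin> \<kappa> ` ball 0 1"
    proof
      assume "- of_real \<rho> \<in> \<kappa> ` ball 0 1"
      then obtain z where z: "z \<in> ball 0 1" and kz: "\<kappa> z = - of_real \<rho>" by (auto simp: image_iff)
      have \<rho>': "1 + complex_of_real \<rho> \<noteq> 0"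
        using \<rho> by (metis add_pos_pos less_irrefl of_real_0 of_real_1 of_real_add of_real_eq_iff zero_less_one)
      have "u z - 1 = - of_real \<rho> * (u z + 1)" using kz u1[OF z] by (simp add: \<kappa>_def field_simps)
      then have "u z * (1 + of_real \<rho>) = 1 - of_real \<rho>" by (simp add: algebra_simps)
      \<comment> \<open>At \<open>-\<rho>\<close> the Cayley variable is
        \<open>(1 - \<rho>) / (1 + \<rho>)\<close>, whose square is \<open>1 - t\<close> by the
        choice of \<open>t\<close>. This leaves only \<open>q z = 0\<close>, a boundary point of the
        half-plane.\<close>
      then have "u z = of_real ((1 - \<rho>) / (1 + \<rho>))" using \<rho>' by (simp add: field_simps)
      then have "W z = of_real (1 - t)" using u2[of z] by (simp add: t1)
      then have "q z = 0" using t by (simp add: W_def)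
      then show False using Req[OF z] by simp
    qed
    have "(W has_field_derivative 4 * of_real t) (at 0)"
      unfolding W_def q_def by (auto intro!: derivative_eq_intros)
    then have "deriv \<kappa> 0 = 4 * of_real t / 4"
      unfolding \<kappa>_def by (intro deriv_cayley_sqrt[OF holu open_ball _ u2 u0]) auto
    then show "deriv \<kappa> 0 = of_real (4 * \<rho> / (1 + \<rho>)\<^sup>2)" by (simp add: t_def)
  qed
qed

text \<open>Composing with a slit map makes \<open>f z\<close> an omitted value, so the quarter theorem applies.\<close>

lemma univalent_growth_lower:
  assumes hol: "f holomorphic_on ball 0 1" and inj: "inj_on f (ball 0 1)" and z: "cmod z < 1"
  shows "cmod (deriv f 0) * cmod z \<le> (1 + cmod z)\<^sup>2 * cmod (f z - f 0)"
proof (cases "z = 0")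
  case False
  define \<rho> where "\<rho> = cmod z"
  define e where "e = z / of_real \<rho>"
  have \<rho>: "0 < \<rho>" "\<rho> < 1" using False z by (auto simp: \<rho>_def)
  have e: "z = e * of_real \<rho>" "cmod e = 1" using \<rho> by (auto simp: e_def norm_divide \<rho>_def)
  obtain \<kappa> where \<kappa>: "\<kappa> holomorphic_on ball 0 1" "inj_on \<kappa> (ball 0 1)" "\<kappa> ` ball 0 1 \<subseteq> ball 0 1"
      "\<kappa> 0 = 0" "deriv \<kappa> 0 = of_real (4 * \<rho> / (1 + \<rho>)\<^sup>2)" "- of_real \<rho> \<notin> \<kappa> ` ball 0 1"
    using radial_slit_map[OF \<rho>] by blast
  define k where "k x = - e * \<kappa> x" for x
  have e0: "e \<noteq> 0" using e by auto
  have holk: "k holomorphic_on ball 0 1" unfolding k_def by (intro holomorphic_intros \<kappa>)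
  have kim: "k ` ball 0 1 \<subseteq> ball 0 1" using \<kappa>(3) e(2) by (auto simp: k_def norm_mult)
  have injk: "inj_on k (ball 0 1)" using \<kappa>(2) e0 by (auto simp: k_def inj_on_def)
  have dk: "(k has_field_derivative - e * deriv \<kappa> 0) (at 0)"
    unfolding k_def by (intro DERIV_cmult holomorphic_derivI[OF \<kappa>(1)]) auto
  have k0: "k 0 = 0" by (simp add: k_def \<kappa>)
  have zk: "z \<notin> k ` ball 0 1"
  proof
    assume "z \<in> k ` ball 0 1"
    then obtain x where x: "x \<in> ball 0 1" "e * of_real \<rho> = - e * \<kappa> x" using e(1) by (auto simp: k_def)
    then have "e * (of_real \<rho> + \<kappa> x) = 0" by (simp add: algebra_simps)
    then have "\<kappa> x = - of_real \<rho>" using e0 by (simp add: eq_neg_iff_add_eq_0 add.commute)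
    then show False using \<kappa>(6) x(1) by (metis image_eqI)
  qed
  have "cmod (deriv (f \<circ> k) 0) \<le> 4 * cmod (f z - (f \<circ> k) 0)"
  proof (rule koebe_quarter)
    show "(f \<circ> k) holomorphic_on ball 0 1"
      by (rule holomorphic_on_compose[OF holk holomorphic_on_subset[OF hol kim]])
    show "inj_on (f \<circ> k) (ball 0 1)"
      by (rule comp_inj_on[OF injk inj_on_subset[OF inj kim]])
    have "z \<in> ball 0 1" using z by simp
    then show "f z \<notin> (f \<circ> k) ` ball 0 1"
      using zk inj_on_image_mem_iff[OF inj _ kim] by (simp add: image_comp)
  qed
  moreover have "deriv (f \<circ> k) 0 = deriv f 0 * (- e * deriv \<kappa> 0)"
    by (rule DERIV_imp_deriv, rule DERIV_chain) (use dk k0 holomorphic_derivI[OF hol open_ball, of 0] in auto)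
  moreover have "cmod (deriv \<kappa> 0) = 4 * \<rho> / (1 + \<rho>)\<^sup>2"
    unfolding \<kappa>(5) norm_of_real using \<rho> by simp
  ultimately have "(4 * (cmod (deriv f 0) * \<rho>)) / (1 + \<rho>)\<^sup>2 \<le> 4 * cmod (f z - f 0)"
    using e(2) by (simp add: norm_mult k0 mult_ac)
  moreover have "(1 + \<rho>)\<^sup>2 > 0" using \<rho> by simp
  ultimately show ?thesis
    by (simp add: pos_divide_le_eq mult_ac flip: \<rho>_def)
qed simp

subsection \<open>Distortion and the conformal radius\<close>

lemma Re_derivative_along_ray:
  assumes "(f has_field_derivative D) (at (of_real t * e))"
  shows "((\<lambda>t. Re (f (of_real t * e))) has_real_derivative Re (D * e)) (at t)"
proof -
  have "((\<lambda>t::real. of_real t * e) has_vector_derivative e) (at t)"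
    by (auto intro!: derivative_eq_intros has_vector_derivative_of_real)
  from field_vector_diff_chain_at[OF this assms]
  have "((\<lambda>t. f (of_real t * e)) has_vector_derivative e * D) (at t)"
    by (simp add: o_def)
  from bounded_linear.has_vector_derivative[OF bounded_linear_Re this]
  show ?thesis
    by (simp add: has_real_derivative_iff_has_vector_derivative mult.commute)
qed

lemma ex_rotation_to_norm: "\<exists>e. cmod e = 1 \<and> Re (D * e) = cmod D"
proof (cases "D = 0")
  case True
  then show ?thesis by (intro exI[of _ 1]) auto
next
  case False
  have "D * (cnj D / of_real (cmod D)) = of_real ((cmod D)\<^sup>2) / of_real (cmod D)"
    using complex_norm_square[of D] by simp
  also have "\<dots> = of_real (cmod D)"
    using False by (simp add: power2_eq_square)
  finally show ?thesis
    using False by (intro exI[of _ "cnj D / of_real (cmod D)"]) (simp add: norm_divide)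
qed

text \<open>Compare both sides along the ray on which \<open>Re Q\<close> grows fastest: they agree
  at the origin, where \<open>(1 + t)^2\<close> has slope \<open>2\<close>, so a steeper
  \<open>Q\<close> would break the bound for small \<open>t\<close>.\<close>

lemma deriv_bound_from_growth:
  assumes hol: "Q holomorphic_on ball 0 1" and Q0: "Q 0 = 1"
    and le: "\<And>z. z \<in> ball 0 1 \<Longrightarrow> cmod (Q z) \<le> (1 + cmod z)\<^sup>2"
  shows "cmod (deriv Q 0) \<le> 2"
proof (rule ccontr)
  assume gt: "\<not> cmod (deriv Q 0) \<le> 2"
  obtain e where e: "cmod e = 1" "Re (deriv Q 0 * e) = cmod (deriv Q 0)"
    using ex_rotation_to_norm by blast
  define \<psi> where "\<psi> t = (1 + t)\<^sup>2 - Re (Q (of_real t * e))" for t :: real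
  have "(Q has_field_derivative deriv Q 0) (at (of_real 0 * e))"
    using holomorphic_derivI[OF hol open_ball, of 0] by simp
  from Re_derivative_along_ray[OF this]
  moreover have "((\<lambda>t::real. (1 + t)\<^sup>2) has_real_derivative 2) (at 0)"
    by (auto intro!: derivative_eq_intros)
  ultimately have "(\<psi> has_real_derivative 2 - cmod (deriv Q 0)) (at 0)"
    unfolding \<psi>_def e(2)[symmetric] by (intro DERIV_diff)
  from DERIV_neg_dec_right[OF this] gt
  obtain d where d: "d > 0" "\<And>t. 0 < t \<Longrightarrow> t < d \<Longrightarrow> \<psi> t < \<psi> 0" by auto
  define t where "t = min d 1 / 2"
  have t: "0 < t" "t < d" "t < 1" using d(1) by (auto simp: t_def)
  have "Re (Q (of_real t * e)) \<le> (1 + t)\<^sup>2"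
    using le[of "of_real t * e"] t e(1) complex_Re_le_cmod[of "Q (of_real t * e)"]
    by (simp add: norm_mult)
  then have "\<psi> 0 \<le> \<psi> t" by (simp add: \<psi>_def Q0)
  with d(2)[OF t(1,2)] show False by simp
qed

text \<open>This is Bieberbach's bound without normalization. With
  \<open>f z - f 0 = z * G z\<close> the growth estimate bounds \<open>G 0 / G z\<close> by
  \<open>(1 + |z|)^2\<close>. Its derivative at \<open>0\<close> is \<open>- G'(0) / G 0\<close>,
  and the second derivative of \<open>f\<close> there is \<open>2 G'(0)\<close>.\<close>

lemma univalent_second_coefficient:
  assumes hol: "f holomorphic_on ball 0 1" and inj: "inj_on f (ball 0 1)"
  shows "cmod (deriv (deriv f) 0) \<le> 4 * cmod (deriv f 0)"
proof -
  have "(\<lambda>z. f z - f 0) holomorphic_on ball 0 1" by (intro holomorphic_intros hol)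
  then obtain G where holG: "G holomorphic_on ball 0 1" and G: "\<And>z. norm z < 1 \<Longrightarrow> f z - f 0 = z * G z"
      and "deriv (\<lambda>z. f z - f 0) 0 = G 0"
    using Schwarz3[of "\<lambda>z. f z - f 0" 1] by auto
  moreover have "deriv (\<lambda>z. f z - f 0) 0 = deriv f 0"
    using holomorphic_derivI[OF hol open_ball, of 0]
    by (intro DERIV_imp_deriv) (auto intro!: derivative_eq_intros)
  ultimately have G0: "deriv f 0 = G 0" by simp
  then have G0nz: "G 0 \<noteq> 0" using holomorphic_injective_imp_regular[OF hol open_ball inj, of 0] by simp
  have growth: "cmod (G 0) \<le> (1 + cmod z)\<^sup>2 * cmod (G z)" if z: "z \<in> ball 0 1" for z
  proof (cases "z = 0")
    case False
    have "cmod (G 0) * cmod z \<le> ((1 + cmod z)\<^sup>2 * cmod (G z)) * cmod z"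
      using univalent_growth_lower[OF hol inj, of z] z G[of z] by (simp add: G0 norm_mult mult_ac)
    then show ?thesis using False by simp
  qed simp
  have Gnz: "G z \<noteq> 0" if "z \<in> ball 0 1" for z
    using growth[OF that] G0nz by auto
  have dG: "(G has_field_derivative deriv G 0) (at 0)"
    using holomorphic_derivI[OF holG open_ball, of 0] by simp
  have "cmod (deriv (\<lambda>z. G 0 / G z) 0) \<le> 2"
  proof (rule deriv_bound_from_growth)
    show "(\<lambda>z. G 0 / G z) holomorphic_on ball 0 1" by (intro holomorphic_intros holG Gnz)
    show "cmod (G 0 / G z) \<le> (1 + cmod z)\<^sup>2" if "z \<in> ball 0 1" for z
      using growth[OF that] Gnz[OF that] by (simp add: norm_divide pos_divide_le_eq)
  qed (simp add: G0nz)
  moreover have "deriv (\<lambda>z. G 0 / G z) 0 = - deriv G 0 / G 0"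
    using dG G0nz by (intro DERIV_imp_deriv) (auto intro!: derivative_eq_intros)
  ultimately have dG_le: "cmod (deriv G 0) \<le> 2 * cmod (deriv f 0)"
    using G0nz by (simp add: norm_divide pos_divide_le_eq G0)
  have df: "deriv f z = G z + z * deriv G z" if z: "z \<in> ball 0 1" for z
  proof (rule DERIV_imp_deriv, rule has_field_derivative_transform_within_open[OF _ open_ball z])
    show "((\<lambda>z. f 0 + z * G z) has_field_derivative G z + z * deriv G z) (at z)"
      using holomorphic_derivI[OF holG open_ball z] by (auto intro!: derivative_eq_intros)
    show "f 0 + x * G x = f x" if "x \<in> ball 0 1" for x
      using G[of x] that by (simp add: algebra_simps)
  qed
  have "((\<lambda>z. G z + z * deriv G z) has_field_derivative deriv G 0 + deriv G 0) (at 0)"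
    using dG holomorphic_derivI[OF holomorphic_deriv[OF holG open_ball] open_ball, of 0]
    by (auto intro!: derivative_eq_intros)
  then have "(deriv f has_field_derivative deriv G 0 + deriv G 0) (at 0)"
    by (rule has_field_derivative_transform_within_open[of _ _ _ "ball 0 1"]) (simp_all only: df open_ball centre_in_ball zero_less_one)
  then have "deriv (deriv f) 0 = 2 * deriv G 0" by (simp add: DERIV_imp_deriv)
  then show ?thesis using dG_le by (simp add: norm_mult)
qed

section \<open>Disc automorphisms and transfer of estimates from the origin to other points\<close>

lemma Moebius_function_minus_denominator_nonzero:
  fixes x z :: complex
  assumes "cmod x < 1" "cmod z < 1"
  shows "1 + cnj x * z \<noteq> 0"
proof
  assume "1 + cnj x * z = 0"
  then have "cnj x * z = - 1" by (simp add: eq_neg_iff_add_eq_0 add.commute)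
  then have "cmod x * cmod z = 1" by (metis complex_mod_cnj norm_minus_cancel norm_mult norm_one)
  moreover have "cmod x * cmod z < 1" using assms by (metis norm_mult_less mult_1 norm_mult)
  ultimately show False by simp
qed

text \<open>With this sign the automorphism is \<open>(z + x) / (1 + cnj x * z)\<close>, which
  carries the origin to \<open>x\<close>.\<close>

lemma Moebius_function_minus_DERIV:
  assumes "cmod x < 1" "cmod z < 1"
  shows "(Moebius_function 0 (- x) has_field_derivative of_real (1 - (cmod x)\<^sup>2) / (1 + cnj x * z)\<^sup>2) (at z)"
proof -
  have "((\<lambda>z. (z + x) / (1 + cnj x * z)) has_field_derivative
      ((1 + cnj x * z) - (z + x) * cnj x) / ((1 + cnj x * z) * (1 + cnj x * z))) (at z)"
    using Moebius_function_minus_denominator_nonzero[OF assms]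
    by (auto intro!: derivative_eq_intros)
  moreover have "(1 + cnj x * z) - (z + x) * cnj x = of_real (1 - (cmod x)\<^sup>2)"
    using complex_norm_square[of x] by (simp add: algebra_simps)
  ultimately show ?thesis
    by (simp add: power2_eq_square Moebius_function_simple[abs_def])
qed

lemma Moebius_function_minus_bij:
  assumes "cmod x < 1"
  shows "bij_betw (Moebius_function 0 (- x)) (ball 0 1) (ball 0 1)"
proof (rule bij_betw_byWitness[where f' = "Moebius_function 0 x"])
  show "\<forall>z\<in>ball 0 1. Moebius_function 0 x (Moebius_function 0 (- x) z) = z"
    using assms by (auto intro!: Moebius_function_compose)
  show "\<forall>z\<in>ball 0 1. Moebius_function 0 (- x) (Moebius_function 0 x z) = z"
    using assms by (auto intro!: Moebius_function_compose)
qed (use assms Moebius_function_norm_lt_1 in auto)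

text \<open>Together with the derivative formula this is equality in the Schwarz--Pick lemma; it
  makes the conformal radius invariant under disc automorphisms.\<close>

lemma one_minus_norm_Moebius_function_minus:
  assumes "cmod x < 1" "cmod z < 1"
  shows "1 - (cmod (Moebius_function 0 (- x) z))\<^sup>2
    = (1 - (cmod x)\<^sup>2) * (1 - (cmod z)\<^sup>2) / (cmod (1 + cnj x * z))\<^sup>2"
proof -
  have "(cmod (1 + cnj x * z))\<^sup>2 - (cmod (z + x))\<^sup>2 = (1 - (cmod x)\<^sup>2) * (1 - (cmod z)\<^sup>2)"
    unfolding cmod_power2 by (simp add: power2_eq_square algebra_simps)
  moreover have "(cmod (1 + cnj x * z))\<^sup>2 \<noteq> 0"
    using Moebius_function_minus_denominator_nonzero[OF assms] by simp
  moreover have "cmod (Moebius_function 0 (- x) z) = cmod (z + x) / cmod (1 + cnj x * z)"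
    by (simp add: Moebius_function_simple norm_divide)
  ultimately show ?thesis
    by (simp add: power_divide diff_divide_eq_iff)
qed

text \<open>Recentring at \<open>x\<close> keeps the image and injectivity and turns the conformal
  radius at \<open>x\<close> into the modulus of the derivative at \<open>0\<close>, so estimates at
  the origin apply at every point.\<close>

lemma koebe_transform:
  fixes f :: "complex \<Rightarrow> complex"
  assumes hol: "f holomorphic_on ball 0 1" and x: "cmod x < 1"
  defines "F \<equiv> f \<circ> Moebius_function 0 (- x)"
  shows "F holomorphic_on ball 0 1" "F 0 = f x" "F ` ball 0 1 = f ` ball 0 1"
    "inj_on f (ball 0 1) \<Longrightarrow> inj_on F (ball 0 1)"
    "\<And>z. cmod z < 1 \<Longrightarrow> deriv F z
       = deriv f (Moebius_function 0 (- x) z) * (of_real (1 - (cmod x)\<^sup>2) / (1 + cnj x * z)\<^sup>2)"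
    "cmod (deriv F 0) = cmod (deriv f x) * (1 - (cmod x)\<^sup>2)"
proof -
  let ?M = "Moebius_function 0 (- x)"
  have M: "?M ` ball 0 1 = ball 0 1" "inj_on ?M (ball 0 1)"
    using Moebius_function_minus_bij[OF x] by (auto simp: bij_betw_def)
  show "F holomorphic_on ball 0 1"
    unfolding F_def using x hol M(1)
    by (intro holomorphic_on_compose Moebius_function_holomorphic) auto
  show F0: "F 0 = f x" by (simp add: F_def Moebius_function_of_zero)
  show "F ` ball 0 1 = f ` ball 0 1" by (simp add: F_def M(1) flip: image_image image_comp)
  show "inj_on F (ball 0 1)" if "inj_on f (ball 0 1)"
    unfolding F_def using M that by (intro comp_inj_on) auto
  show dF: "deriv F z = deriv f (?M z) * (of_real (1 - (cmod x)\<^sup>2) / (1 + cnj x * z)\<^sup>2)" if z: "cmod z < 1" for z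
    unfolding F_def
  proof (rule DERIV_imp_deriv, rule DERIV_chain[OF _ Moebius_function_minus_DERIV[OF x z]])
    show "(f has_field_derivative deriv f (?M z)) (at (?M z))"
      using M(1) z by (intro holomorphic_derivI[OF hol]) auto
  qed
  have "(cmod x)\<^sup>2 < 1" using x by (simp add: power_less_one_iff)
  then show "cmod (deriv F 0) = cmod (deriv f x) * (1 - (cmod x)\<^sup>2)"
    using dF[of 0] norm_of_real[of "1 - (cmod x)\<^sup>2", where 'a = complex]
    by (simp add: Moebius_function_of_zero norm_mult del: norm_of_real)
qed

text \<open>This is the second coefficient bound for the Koebe transform. Both its second and its
  first derivative at \<open>0\<close> contain a factor \<open>s = 1 - |x|^2\<close>, which
  cancels.\<close>

lemma univalent_second_derivative:
  assumes hol: "f holomorphic_on ball 0 1" and inj: "inj_on f (ball 0 1)" and x: "cmod x < 1"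
  shows "cmod (deriv (deriv f) x * of_real (1 - (cmod x)\<^sup>2) - 2 * cnj x * deriv f x) \<le> 4 * cmod (deriv f x)"
proof -
  define s where "s = 1 - (cmod x)\<^sup>2"
  have s: "s > 0" using x by (simp add: s_def power_less_one_iff)
  let ?M = "Moebius_function 0 (- x)"
  note F = koebe_transform[OF hol x]
  have M0: "?M 0 = x" by (simp add: Moebius_function_of_zero)
  have dM: "(?M has_field_derivative of_real s) (at 0)"
    using Moebius_function_minus_DERIV[OF x, of 0] by (simp add: s_def)
  have "(deriv f has_field_derivative deriv (deriv f) x) (at (?M 0))"
    unfolding M0 using x by (intro holomorphic_derivI[OF holomorphic_deriv[OF hol open_ball] open_ball]) auto
  from DERIV_chain2[OF this dM]
  have "((\<lambda>z. deriv f (?M z) * (of_real s / (1 + cnj x * z)\<^sup>2)) has_field_derivative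
     deriv (deriv f) x * of_real s * of_real s + deriv f x * (- 2 * cnj x * of_real s)) (at 0)"
    by (auto intro!: derivative_eq_intros simp: M0 power2_eq_square)
  then have "(deriv (f \<circ> ?M) has_field_derivative
     deriv (deriv f) x * of_real s * of_real s + deriv f x * (- 2 * cnj x * of_real s)) (at 0)"
    by (rule has_field_derivative_transform_within_open[of _ _ _ "ball 0 1"]) (auto simp: F(5) s_def)
  then have "deriv (deriv (f \<circ> ?M)) 0 = (deriv (deriv f) x * of_real s - 2 * cnj x * deriv f x) * of_real s"
    by (simp add: DERIV_imp_deriv algebra_simps)
  then have "cmod (deriv (deriv f) x * of_real s - 2 * cnj x * deriv f x) * s \<le> (4 * cmod (deriv f x)) * s"
    using univalent_second_coefficient[OF F(1) F(4)[OF inj]] F(6) s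
    by (simp add: norm_mult flip: s_def)
  then show ?thesis using s by (simp add: s_def)
qed

lemma univalent_distortion_lower:
  assumes hol: "f holomorphic_on ball 0 1" and inj: "inj_on f (ball 0 1)" and z: "cmod z < 1"
  shows "cmod (deriv f 0) * (1 - cmod z) \<le> cmod (deriv f z) * (1 + cmod z) ^ 3"
proof -
  have hol': "deriv f holomorphic_on ball 0 1" by (rule holomorphic_deriv[OF hol open_ball])
  have nz: "deriv f w \<noteq> 0" if "w \<in> ball 0 1" for w
    using holomorphic_injective_imp_regular[OF hol open_ball inj that] .
  obtain l where holl: "l holomorphic_on ball 0 1" and l: "\<And>w. w \<in> ball 0 1 \<Longrightarrow> deriv f w = exp (l w)"
    using contractible_imp_holomorphic_log[OF hol' _ nz] convex_imp_contractible[OF convex_ball] by metis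
  define \<rho> where "\<rho> = cmod z"
  have \<rho>: "0 \<le> \<rho>" "\<rho> < 1" using z by (auto simp: \<rho>_def)
  obtain e where e: "cmod e = 1" "z = of_real \<rho> * e"
  proof (cases "z = 0")
    case True
    then show thesis using that[of 1] by (simp add: \<rho>_def)
  next
    case False
    then show thesis using that[of "z / of_real \<rho>"] by (simp add: \<rho>_def norm_divide)
  qed
  \<comment> \<open>Monotonicity of \<open>\<phi>\<close> is the logarithmic form of the claim. The
    second derivative estimate gives the lower bound \<open>- (4 - 2 t) / (1 - t^2)\<close> for the
    radial derivative of \<open>log |f'|\<close>, and partial fractions split it into
    \<open>- 1 / (1 - t) - 3 / (1 + t)\<close>.\<close>
  define \<phi> where "\<phi> t = Re (l (of_real t * e)) - ln (1 - t) + 3 * ln (1 + t)" for t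
  have "\<phi> 0 \<le> \<phi> \<rho>"
  proof (rule DERIV_nonneg_imp_nondecreasing[OF \<rho>(1)])
    fix t assume t: "0 \<le> t" "t \<le> \<rho>"
    define x where "x = of_real t * e"
    have xt: "cmod x = t" using t e by (simp add: x_def norm_mult)
    then have x: "x \<in> ball 0 1" using t \<rho> by simp
    have dl: "(l has_field_derivative deriv l x) (at x)" by (rule holomorphic_derivI[OF holl open_ball x])
    have "(deriv f has_field_derivative deriv f x * deriv l x) (at x)"
    proof (rule has_field_derivative_transform_within_open[OF _ open_ball x])
      show "((\<lambda>w. exp (l w)) has_field_derivative deriv f x * deriv l x) (at x)"
        using dl l[OF x] by (auto intro!: derivative_eq_intros)
    qed (use l in auto)
    then have ddf: "deriv (deriv f) x = deriv f x * deriv l x" by (rule DERIV_imp_deriv)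
    have "cmod (deriv f x) * cmod (deriv l x * of_real (1 - t\<^sup>2) - 2 * cnj x) \<le> cmod (deriv f x) * 4"
      using univalent_second_derivative[OF hol inj, of x] x xt
      by (simp add: ddf algebra_simps flip: norm_mult)
    then have "cmod (deriv l x * of_real (1 - t\<^sup>2) - 2 * cnj x) \<le> 4"
      using nz[OF x] by simp
    then have "cmod ((deriv l x * of_real (1 - t\<^sup>2) - 2 * cnj x) * e) \<le> 4"
      using e(1) by (simp add: norm_mult)
    then have "- 4 \<le> Re ((deriv l x * of_real (1 - t\<^sup>2) - 2 * cnj x) * e)"
      using abs_Re_le_cmod order_trans abs_le_D2 minus_le_iff by metis
    \<comment> \<open>Because \<open>|e| = 1\<close> and \<open>x = t e\<close>, the product
      \<open>cnj x * e\<close> is the real number \<open>t\<close>.\<close>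
    also have "(deriv l x * of_real (1 - t\<^sup>2) - 2 * cnj x) * e = of_real (1 - t\<^sup>2) * (deriv l x * e) - of_real (2 * t)"
      using complex_norm_square[of e] e(1) by (simp add: x_def algebra_simps)
    finally have key: "2 * t - 4 \<le> (1 - t\<^sup>2) * Re (deriv l x * e)"
      unfolding scaleR_conv_of_real[symmetric] minus_complex.sel scaleR_complex.sel Re_complex_of_real
      by linarith
    have t1: "1 - t\<^sup>2 > 0" "1 - t > 0" "1 + t > 0" using t \<rho> by (auto simp: power_less_one_iff abs_square_less_1)
    have "1 / (1 - t) + 3 / (1 + t) = (4 - 2 * t) / (1 - t\<^sup>2)"
      using t1 by (simp add: field_simps) (simp add: power2_eq_square algebra_simps)
    moreover have "- (4 - 2 * t) / (1 - t\<^sup>2) \<le> Re (deriv l x * e)"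
      using key t1 by (simp add: pos_divide_le_eq mult.commute)
    ultimately have nonneg: "0 \<le> Re (deriv l x * e) + (3 * (1 / (1 + t)) - - (1 / (1 - t)))"
      unfolding minus_divide_left[symmetric] by linarith
    have "((\<lambda>t. ln (1 + t)) has_real_derivative 1 / (1 + t)) (at t)"
      using t1(3) by (auto intro!: derivative_eq_intros)
    moreover have "((\<lambda>t. ln (1 - t)) has_real_derivative - (1 / (1 - t))) (at t)"
      using t1(2) by (auto intro!: derivative_eq_intros simp: divide_simps)
    ultimately have "((\<lambda>t. Re (l (of_real t * e)) + (3 * ln (1 + t) - ln (1 - t))) has_real_derivative
        Re (deriv l x * e) + (3 * (1 / (1 + t)) - - (1 / (1 - t)))) (at t)"
      unfolding x_def
      by (intro DERIV_add DERIV_diff DERIV_cmult Re_derivative_along_ray[OF dl[unfolded x_def]])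
    moreover have "\<phi> = (\<lambda>t. Re (l (of_real t * e)) + (3 * ln (1 + t) - ln (1 - t)))"
      by (simp add: \<phi>_def fun_eq_iff)
    ultimately have "(\<phi> has_real_derivative Re (deriv l x * e) + (3 * (1 / (1 + t)) - - (1 / (1 - t)))) (at t)"
      by (simp only:)
    with nonneg show "\<exists>y. (\<phi> has_real_derivative y) (at t) \<and> y \<ge> 0" by blast
  qed
  then have "Re (l 0) + ln (1 - \<rho>) \<le> Re (l z) + 3 * ln (1 + \<rho>)"
    using e by (simp add: \<phi>_def)
  then have "exp (Re (l 0)) * exp (ln (1 - \<rho>)) \<le> exp (Re (l z)) * exp (real 3 * ln (1 + \<rho>))"
    by (simp flip: exp_add)
  moreover have "exp (ln (1 - \<rho>)) = 1 - \<rho>" "exp (ln (1 + \<rho>)) = 1 + \<rho>"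
    using \<rho> by simp_all
  ultimately show ?thesis
    using l[of 0] l[of z] z
    unfolding exp_of_nat_mult by (simp add: norm_exp_eq_Re \<rho>_def)
qed

text \<open>\<open>|f'(z)| (1 - |z|\<^sup>2)\<close> is the conformal radius of the image domain at \<open>f z\<close>.\<close>

lemma conformal_radius_lipschitz_0:
  assumes hol: "f holomorphic_on ball 0 1" and inj: "inj_on f (ball 0 1)" and z: "cmod z < 1"
  shows "cmod (deriv f 0) - 4 * cmod (f z - f 0) \<le> cmod (deriv f z) * (1 - (cmod z)\<^sup>2)"
proof -
  define \<rho> where "\<rho> = cmod z"
  define A where "A = cmod (deriv f 0)"
  define B where "B = cmod (deriv f z)"
  define G where "G = cmod (f z - f 0)"
  have \<rho>: "0 \<le> \<rho>" "\<rho> < 1" using z by (auto simp: \<rho>_def)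
  have growth: "A * \<rho> \<le> (1 + \<rho>)\<^sup>2 * G"
    using univalent_growth_lower[OF hol inj z] by (simp add: A_def \<rho>_def G_def)
  have "A * (1 - \<rho>) \<le> B * (1 + \<rho>) ^ 3"
    using univalent_distortion_lower[OF hol inj z] by (simp add: A_def B_def \<rho>_def)
  then have "A * (1 - \<rho>) * (1 - \<rho>) \<le> B * (1 + \<rho>) ^ 3 * (1 - \<rho>)"
    using \<rho> by (intro mult_right_mono) auto
  \<comment> \<open>The identity \<open>(1 - \<rho>)^2 + 4 \<rho> = (1 + \<rho>)^2\<close> combines
    distortion, multiplied by \<open>1 - \<rho>\<close>, with four times the growth
    estimate.\<close>
  with growth have "(A - 4 * G) * (1 + \<rho>)\<^sup>2 \<le> (B * (1 - \<rho>\<^sup>2)) * (1 + \<rho>)\<^sup>2"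
    by (simp add: power2_eq_square power3_eq_cube algebra_simps)
  moreover have "0 < (1 + \<rho>)\<^sup>2" using \<rho> by simp
  ultimately have "A - 4 * G \<le> B * (1 - \<rho>\<^sup>2)" by (rule mult_right_le_imp_le)
  then show ?thesis by (simp add: A_def B_def G_def \<rho>_def)
qed

lemma conformal_radius_lipschitz:
  assumes hol: "f holomorphic_on ball 0 1" and inj: "inj_on f (ball 0 1)"
    and x: "cmod x < 1" and z: "cmod z < 1"
  shows "cmod (deriv f x) * (1 - (cmod x)\<^sup>2) - 4 * cmod (f z - f x) \<le> cmod (deriv f z) * (1 - (cmod z)\<^sup>2)"
proof -
  let ?M = "Moebius_function 0 (- x)"
  note F = koebe_transform[OF hol x]
  have "z \<in> ?M ` ball 0 1"
    using Moebius_function_minus_bij[OF x] z by (simp add: bij_betw_def)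
  then obtain w where w: "cmod w < 1" "z = ?M w" by auto
  have "(cmod x)\<^sup>2 < 1" using x by (simp add: power_less_one_iff)
  then have "cmod (of_real (1 - (cmod x)\<^sup>2)) = 1 - (cmod x)\<^sup>2"
    unfolding norm_of_real by simp
  then have "cmod (deriv (f \<circ> ?M) w) * (1 - (cmod w)\<^sup>2) = cmod (deriv f z) * (1 - (cmod z)\<^sup>2)"
    unfolding F(5)[OF w(1)] norm_mult norm_divide norm_power w(2) one_minus_norm_Moebius_function_minus[OF x w(1)]
    by simp
  then show ?thesis
    using conformal_radius_lipschitz_0[OF F(1) F(4)[OF inj] w(1)] by (simp add: F(6) F(2)[unfolded o_def] w(2) flip: o_def)
qed

lemma koebe_quarter_at:
  assumes hol: "f holomorphic_on ball 0 1" and inj: "inj_on f (ball 0 1)"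
    and x: "cmod x < 1" and c: "c \<notin> f ` ball 0 1"
  shows "cmod (deriv f x) * (1 - (cmod x)\<^sup>2) \<le> 4 * cmod (c - f x)"
proof -
  note F = koebe_transform[OF hol x]
  show ?thesis
    using koebe_quarter[OF F(1) F(4)[OF inj], of c] c by (simp add: F(2,3,6) del: o_apply)
qed

text \<open>The Schwarz lemma applies to \<open>g^{-1} \<circ> f\<close>, a self-map of the disc
  fixing the origin; the chain rule then compares the derivatives.\<close>

lemma subordination_0:
  assumes holf: "f holomorphic_on ball 0 1" and holg: "g holomorphic_on ball 0 1"
    and inj: "inj_on g (ball 0 1)" and sub: "f ` ball 0 1 \<subseteq> g ` ball 0 1" and eq: "f 0 = g 0"
  shows "cmod (deriv f 0) \<le> cmod (deriv g 0)"
proof -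
  obtain k where holk: "k holomorphic_on g ` ball 0 1"
      and "\<And>z. z \<in> ball 0 1 \<Longrightarrow> deriv g z * deriv k (g z) = 1"
      and kg: "\<And>z. z \<in> ball 0 1 \<Longrightarrow> k (g z) = z"
    using holomorphic_has_inverse[OF holg open_ball inj] by blast
  have hol: "(k \<circ> f) holomorphic_on ball 0 1"
    by (rule holomorphic_on_compose[OF holf holomorphic_on_subset[OF holk sub]])
  have im: "(k \<circ> f) z \<in> ball 0 1" "g ((k \<circ> f) z) = f z" if "z \<in> ball 0 1" for z
  proof -
    obtain w where "w \<in> ball 0 1" "f z = g w" using sub \<open>z \<in> ball 0 1\<close> by blast
    then show "(k \<circ> f) z \<in> ball 0 1" "g ((k \<circ> f) z) = f z" using kg by auto
  qed
  have 0: "(k \<circ> f) 0 = 0" using eq kg[of 0] by simp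
  have "cmod (deriv (k \<circ> f) 0) \<le> 1"
    by (rule Schwarz_Lemma(2)[OF hol 0, of 0]) (use im(1) in \<open>simp_all del: o_apply\<close>)
  moreover have "(f has_field_derivative deriv g 0 * deriv (k \<circ> f) 0) (at 0)"
  proof (rule has_field_derivative_transform_within_open[of _ _ _ "ball 0 1"])
    show "(g \<circ> (k \<circ> f) has_field_derivative deriv g 0 * deriv (k \<circ> f) 0) (at 0)"
    proof (rule DERIV_chain)
      show "(k \<circ> f has_field_derivative deriv (k \<circ> f) 0) (at 0)"
        by (rule holomorphic_derivI[OF hol open_ball]) simp
      show "(g has_field_derivative deriv g 0) (at ((k \<circ> f) 0))"
        unfolding 0 by (rule holomorphic_derivI[OF holg open_ball]) simp
    qed
  qed (use im in auto)
  then have "deriv f 0 = deriv g 0 * deriv (k \<circ> f) 0" by (rule DERIV_imp_deriv)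
  ultimately show ?thesis by (simp add: norm_mult mult_left_le)
qed

text \<open>In the final theorem \<open>f\<close> is the contracted map \<open>e * h\<close> and
  \<open>g\<close> is \<open>h\<close>, whose images are nested by spirallikeness.\<close>

lemma conformal_radius_mono:
  assumes holf: "f holomorphic_on ball 0 1" and holg: "g holomorphic_on ball 0 1"
    and inj: "inj_on g (ball 0 1)" and sub: "f ` ball 0 1 \<subseteq> g ` ball 0 1"
    and x: "cmod x < 1" and y: "cmod y < 1" and eq: "f x = g y"
  shows "cmod (deriv f x) * (1 - (cmod x)\<^sup>2) \<le> cmod (deriv g y) * (1 - (cmod y)\<^sup>2)"
proof -
  note F = koebe_transform[OF holf x] and G = koebe_transform[OF holg y]
  show ?thesis
    using subordination_0[OF F(1) G(1) G(4)[OF inj]] sub eq by (simp only: F(2,3,6) G(2,3,6))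
qed

subsection \<open>The extension operator\<close>

theorem theorem3:
  fixes r :: real and \<mu> :: complex
    and h p :: "complex \<Rightarrow> complex"
    and H :: "complex \<times> 'a::complex_banach \<Rightarrow> complex \<times> 'a"
    and B :: "'a \<Rightarrow>\<^sub>L 'a"
    and z\<^sub>0 :: complex and w\<^sub>0 :: 'a
    and t :: real and \<gamma> x\<^sub>1 :: complex
  assumes "r \<ge> 1"
    and "Re \<mu> > 0"
    and "spirallike \<mu> h"
    and "power_branch_on (ball 0 1) (deriv h) (1 / r) p"
    and "H = extension_map h p"
    and "B \<in> bounded_clinear_ops"
    and "generates_strict_contractions B"
    and "(z\<^sub>0, w\<^sub>0) \<in> H ` egg_ball r"
    and "t > 0"
    and "x\<^sub>1 = the_inv_into (ball 0 1) h (exp (- \<mu> * of_real t) * z\<^sub>0)"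
    and "cmod \<gamma> < (1 - norm (blinfun_exp (- (t *\<^sub>R B))) powr r) / 4
                  * cmod (deriv h x\<^sub>1) * (1 - (cmod x\<^sub>1)\<^sup>2)"
  shows "(exp (- \<mu> * of_real t) * z\<^sub>0 + \<gamma>,
          exp (- (\<mu> / of_real r) * of_real t) *\<^sub>C blinfun_apply (blinfun_exp (- (t *\<^sub>R B))) w\<^sub>0)
         \<in> H ` egg_ball r"
proof -
  define e where "e = exp (- \<mu> * of_real t)"
  define E where "E = blinfun_exp (- (t *\<^sub>R B))"
  define E' where "E' = exp (- (\<mu> / of_real r) * of_real t)"
  define c where "c = norm E powr r"
  define K where "K x = cmod (deriv h x) * (1 - (cmod x)\<^sup>2)" for x
  have r: "r > 0" using assms(1) by simp
  have hol: "h holomorphic_on ball 0 1" and inj: "inj_on h (ball 0 1)"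
    and inv: "(\<lambda>z. e * z) ` h ` ball 0 1 \<subseteq> h ` ball 0 1"
    using assms(3,9) unfolding spirallike_def e_def by auto
  have inv_h: "e * h x \<in> h ` ball 0 1" if "cmod x < 1" for x
    using inv that by (simp add: image_subset_iff)
  \<comment> \<open>Only the modulus of the branch enters the norm estimate:
    \<open>|exp (l / r)|^r = exp (Re l) = |h'|\<close>.\<close>
  have p: "cmod (p x) powr r = cmod (deriv h x)" "p x \<noteq> 0" if "x \<in> ball 0 1" for x
  proof -
    obtain l where l: "deriv h x = exp (l x)" "p x = exp (of_real (1 / r) * l x)"
      using assms(4) \<open>x \<in> ball 0 1\<close> unfolding power_branch_on_def by metis
    then show "cmod (p x) powr r = cmod (deriv h x)"
      using r by (simp add: powr_def norm_exp_eq_Re)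
    show "p x \<noteq> 0" by (simp add: l)
  qed
  \<comment> \<open>The spiral factor in the fibre, raised to the power \<open>r\<close>, is exactly
    the factor by which the base map scales conformal radii.\<close>
  have E': "cmod E' powr r = cmod e"
    using r by (simp add: E'_def e_def powr_def norm_exp_eq_Re)
  obtain x0 y0 where z0: "z\<^sub>0 = h x0" and w0: "w\<^sub>0 = p x0 *\<^sub>C y0"
    and xy: "(cmod x0)\<^sup>2 + norm y0 powr r < 1"
    using assms(5,8) by (auto simp: extension_map_def egg_ball_def)
  have "(cmod x0)\<^sup>2 < 1" using xy by (smt (verit) powr_ge_zero)
  then have x0: "cmod x0 < 1" by (simp add: power_less_one_iff)
  have "e * z\<^sub>0 \<in> h ` ball 0 1" using inv_h x0 z0 by simp
  then have x1: "cmod x\<^sub>1 < 1" "h x\<^sub>1 = e * z\<^sub>0"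
    using assms(10) the_inv_into_into[OF inj _ order_refl, of "e * z\<^sub>0"] f_the_inv_into_f[OF inj, of "e * z\<^sub>0"]
    by (auto simp: e_def)
  have "deriv (\<lambda>z. e * h z) x0 = e * deriv h x0"
    using x0 hol holomorphic_on_imp_differentiable_at by (intro deriv_cmult) auto
  moreover have "cmod (deriv (\<lambda>z. e * h z) x0) * (1 - (cmod x0)\<^sup>2) \<le> K x\<^sub>1"
    unfolding K_def
    by (rule conformal_radius_mono[OF _ hol inj])
       (use inv_h x0 x1 z0 in \<open>auto intro!: holomorphic_intros hol\<close>)
  ultimately have K01: "cmod e * K x0 \<le> K x\<^sub>1" by (simp add: K_def norm_mult mult_ac)
  have \<gamma>: "cmod \<gamma> < (1 - c) / 4 * K x\<^sub>1"
    using assms(11) by (simp add: c_def E_def K_def mult_ac)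
  have "deriv h x\<^sub>1 \<noteq> 0"
    using holomorphic_injective_imp_regular[OF hol open_ball inj] x1 by simp
  then have K1: "K x\<^sub>1 > 0" using x1 by (simp add: K_def power_less_one_iff)
  \<comment> \<open>As \<open>c\<close> is nonnegative, \<open>\<gamma>\<close> stays below a
    quarter of the conformal radius, within reach of the quarter theorem.\<close>
  have "0 \<le> c * K x\<^sub>1" using K1 by (simp add: c_def)
  with \<gamma> have "4 * cmod \<gamma> < K x\<^sub>1" by (simp add: field_simps)
  then have "h x\<^sub>1 + \<gamma> \<in> h ` ball 0 1"
    using koebe_quarter_at[OF hol inj x1(1), of "h x\<^sub>1 + \<gamma>"] by (auto simp: K_def)
  then obtain x2 where x2: "cmod x2 < 1" "h x2 = h x\<^sub>1 + \<gamma>" by auto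
  have "K x\<^sub>1 - 4 * cmod \<gamma> \<le> K x2"
    using conformal_radius_lipschitz[OF hol inj x1(1) x2(1)] by (simp add: x2 K_def)
  with \<gamma> have cK: "c * K x\<^sub>1 < K x2" by (simp add: field_simps)
  \<comment> \<open>This is the solution of
    \<open>p x2 *\<^sub>C y2 = E' *\<^sub>C E w\<^sub>0\<close>, so only membership of
    \<open>(x2, y2)\<close> in the ball remains.\<close>
  define y2 where "y2 = (E' / p x2) *\<^sub>C blinfun_apply E w\<^sub>0"
  have px2: "p x2 \<noteq> 0" "cmod (p x2) powr r = cmod (deriv h x2)" using p x2 by auto
  have d2: "cmod (deriv h x2) > 0"
    using holomorphic_injective_imp_regular[OF hol open_ball inj] x2 by simp
  have "norm y2 \<le> cmod E' / cmod (p x2) * (norm E * (cmod (p x0) * norm y0))"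
    unfolding y2_def norm_scaleC norm_divide
    using norm_blinfun[of E w\<^sub>0] by (intro mult_left_mono) (auto simp: w0 norm_scaleC)
  then have "norm y2 powr r \<le> (cmod E' / cmod (p x2) * (norm E * (cmod (p x0) * norm y0))) powr r"
    using r by (intro powr_mono2) auto
  also have "\<dots> = cmod e / cmod (deriv h x2) * (c * (cmod (deriv h x0) * norm y0 powr r))"
    using p(1)[of x0] x0 by (simp add: powr_mult powr_divide E' px2 c_def)
  \<comment> \<open>Membership of \<open>(x0, y0)\<close> in the ball bounds
    \<open>norm y0 powr r\<close> by \<open>1 - |x0|^2\<close>, and with \<open>|h'(x0)|\<close>
    this becomes the conformal radius \<open>K x0\<close>.\<close>
  also have "\<dots> \<le> cmod e / cmod (deriv h x2) * (c * K x0)"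
    unfolding K_def using xy by (intro mult_left_mono) (auto simp: c_def)
  also have "\<dots> = c * (cmod e * K x0) / cmod (deriv h x2)"
    by simp
  also have "\<dots> \<le> c * K x\<^sub>1 / cmod (deriv h x2)"
    using K01 d2 by (intro divide_right_mono mult_left_mono) (auto simp: c_def)
  \<comment> \<open>Dividing the strict inequality \<open>cK\<close> by \<open>|h'(x2)|\<close>
    leaves precisely the room available in the fibre over \<open>x2\<close>.\<close>
  also have "\<dots> < 1 - (cmod x2)\<^sup>2"
    using cK d2 by (simp add: K_def pos_divide_less_eq mult.commute)
  finally have "(x2, y2) \<in> egg_ball r" by (simp add: egg_ball_def)
  moreover have "H (x2, y2) = (e * z\<^sub>0 + \<gamma>, E' *\<^sub>C blinfun_apply E w\<^sub>0)"
    using px2 x1 x2 by (simp add: assms(5) extension_map_def y2_def scaleC_scaleC)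
  ultimately show ?thesis
    unfolding e_def E'_def E_def by (metis image_eqI)
qed

end
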